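(* Let $P(\lambda)=\sum_{i=0}^k P_i\,n_i(\lambda)$, $P_i\in\mathbb{C}^{m\times n}$, be an $m\times n$ matrix polynomial expressed in the Newton basis associated with the nodes $\{x_1,\ldots,x_k\}$, and let $0\le\mu\le k-1$ be an integer. Let $A$ and $B$ be two arbitrary complex matrices of sizes $(\mu+1)m\times(k-\mu-1)n$ and $\mu m\times(k-\mu)n$, respectively. Then the pencil $$\mathcal{N}(\lambda)=\begin{bmatrix} M_\mu^N(\lambda)+AK_1^N(\lambda)+K_2^N(\lambda)^TB & K_2^N(\lambda)^T\\ K_1^N(\lambda) & 0\end{bmatrix}$$ is a strong linearization of $P(\lambda)$ (considered as a matrix polynomial of grade $k$).
   Context: Newton setting. Let $k\ge1$, $m,n\ge 1$ be integers and $x_1,\ldots,x_k\in\mathbb{C}$ distinct nodes. Put $\gamma_j(\lambda)=\lambda-x_j$, and $n_i^j(\lambda)=\prod_{\ell=i}^j\gamma_\ell(\lambda)$ if $j\ge i$, $n_i^j(\lambda)=1$ if $j<i$. The Newton polynomials are $n_0(\lambda)=1$, $n_j(\lambda)=n_1^j(\lambda)$. For an integer $0\le\mu\le k-1$ define $$K_1^N(\lambda)=\begin{bmatrix}-I_n&\gamma_{k-1}(\lambda)I_n\\&-I_n&\gamma_{k-2}(\lambda)I_n\\&&\ddots&\ddots\\&&&-I_n&\gamma_{\mu+1}(\lambda)I_n\end{bmatrix},\quad K_2^N(\lambda)=\begin{bmatrix}-I_m&\gamma_{\mu}(\lambda)I_m\\&-I_m&\gamma_{\mu-1}(\lambda)I_m\\&&\ddots&\ddots\\&&&-I_m&\gamma_{1}(\lambda)I_m\end{bmatrix},$$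 of sizes $(k-\mu-1)n\times(k-\mu)n$ and $\mu m\times(\mu+1)m$ ($K_1^N$ is empty if $\mu=k-1$, $K_2^N$ is empty if $\mu=0$). The pencil $M_\mu^N(\lambda)$ is the $(\mu+1)\times(k-\mu)$ block matrix with $m\times n$ blocks given as follows. If $\mu\le k-2$: its first block row is $[\gamma_k(\lambda)P_k+P_{k-1},\ P_{k-2},\ \ldots,\ P_{\mu+1},\ P_\mu]$, its last block column has, from top to bottom, the blocks $P_\mu,P_{\mu-1},\ldots,P_1,P_0$, and all other blocks are $0$. If $\mu=k-1$: it is the single block column with blocks $\gamma_k(\lambda)P_k+P_{k-1},\,P_{k-2},\ldots,P_0$. Linearizations. A matrix polynomial of grade $g$ is one written $\sum_{i=0}^gQ_i\lambda^i$ (with $Q_g$ possibly zero), and $\mathrm{rev}_gQ(\lambda)=\lambda^gQ(1/\lambda)$. A matrix pencil is a matrix polynomial of grade 1. A matrix polynomial is unimodular if it is square with nonzero constant determinant. A pencil $L(\lambda)$ is a linearization of $P(\lambda)$ if $U(\lambda)L(\lambda)V(\lambda)=\mathrm{diag}(I_s,P(\lambda))$ for some integer $s\ge0$ and unimodular $U,V$. A linearization $L(\lambda)$ of a grade-$k$ matrix polynomial $P(\lambda)$ is strong if moreover $\mathrm{rev}_1L(\lambda)$ is a linearization of $\mathrm{rev}_kP(\lambda)$. *)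

theory Defs
  imports Complex_Main "Jordan_Normal_Form.Determinant"
begin

text \<open>
  A complex matrix polynomial is a matrix over \<^typ>\<open>complex poly\<close>. The grade is not part of
  the object: it is an explicit parameter \<open>g\<close>, bounding the degrees of all entries.
\<close>

definition has_grade :: "nat \<Rightarrow> complex poly mat \<Rightarrow> bool" where
  "has_grade g Q \<longleftrightarrow> (\<forall>i < dim_row Q. \<forall>j < dim_col Q. degree (Q $$ (i, j)) \<le> g)"

text \<open>
  The entries of \<open>\<Sum>i\<le>g. Q\<^sub>i \<lambda>\<^sup>g\<^sup>-\<^sup>i\<close>; unlike \<^const>\<open>reflect_poly\<close>, the reversal is
  with respect to the grade \<open>g\<close> and not to the degree.
\<close>

definition rev_poly :: "nat \<Rightarrow> complex poly \<Rightarrow> complex poly" where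
  "rev_poly g q = (\<Sum>i\<le>g. monom (coeff q i) (g - i))"

lemma poly_rev_poly:
  assumes "degree q \<le> g" and "z \<noteq> 0"
  shows "poly (rev_poly g q) z = z ^ g * poly q (1 / z)"
proof -
  have "poly q (1 / z) = (\<Sum>i\<le>g. coeff q i * (1 / z) ^ i)"
    unfolding poly_altdef using assms(1)
    by (intro sum.mono_neutral_left) (auto simp: coeff_eq_0)
  moreover have "poly (rev_poly g q) z = (\<Sum>i\<le>g. coeff q i * z ^ (g - i))"
    by (simp add: rev_poly_def poly_sum poly_monom)
  moreover have "z ^ (g - i) = z ^ g * (1 / z) ^ i" if "i \<le> g" for i
    using that assms(2) by (simp add: power_diff power_divide)
  ultimately show ?thesis
    by (simp add: sum_distrib_left mult_ac)
qed

definition rev_mat :: "nat \<Rightarrow> complex poly mat \<Rightarrow> complex poly mat" where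
  "rev_mat g Q = map_mat (rev_poly g) Q"

definition unimodular :: "complex poly mat \<Rightarrow> bool" where
  "unimodular U \<longleftrightarrow> square_mat U \<and> (\<exists>c. c \<noteq> 0 \<and> det U = [:c:])"

text \<open>
  The conditions \<open>dim_row U = dim_row L\<close> and \<open>dim_row V = dim_col L\<close> say that the product is
  defined; the matrix product of the library is total and does not enforce this.
\<close>

definition is_linearization :: "complex poly mat \<Rightarrow> complex poly mat \<Rightarrow> bool" where
  "is_linearization L P \<longleftrightarrow> has_grade 1 L \<and>
     (\<exists>s U V. unimodular U \<and> unimodular V \<and> dim_row U = dim_row L \<and> dim_row V = dim_col L \<and>
        U * L * V =
          four_block_mat (1\<^sub>m s) (0\<^sub>m s (dim_col P)) (0\<^sub>m (dim_row P) s) P)"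

definition is_strong_linearization :: "nat \<Rightarrow> complex poly mat \<Rightarrow> complex poly mat \<Rightarrow> bool" where
  "is_strong_linearization k L P \<longleftrightarrow> has_grade k P \<and>
     is_linearization L P \<and> is_linearization (rev_mat 1 L) (rev_mat k P)"

definition node_factor :: "(nat \<Rightarrow> complex) \<Rightarrow> nat \<Rightarrow> complex poly" where
  "node_factor x j = [:- x j, 1:]"

definition newton_poly :: "(nat \<Rightarrow> complex) \<Rightarrow> nat \<Rightarrow> complex poly" where
  "newton_poly x j = (\<Prod>l\<in>{1..j}. node_factor x l)"

definition newton_matpoly ::
  "nat \<Rightarrow> nat \<Rightarrow> nat \<Rightarrow> (nat \<Rightarrow> complex) \<Rightarrow> (nat \<Rightarrow> complex mat) \<Rightarrow> complex poly mat" where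
  "newton_matpoly k m n x P =
     mat m n (\<lambda>(a, b). \<Sum>i\<le>k. smult (P i $$ (a, b)) (newton_poly x i))"

text \<open>
  The \<open>R \<times> C\<close> block matrix whose \<open>(i, j)\<close> block, counted from \<open>0\<close>, is the \<open>p \<times> q\<close> matrix \<open>F i j\<close>.
\<close>

definition block_matrix ::
  "nat \<Rightarrow> nat \<Rightarrow> nat \<Rightarrow> nat \<Rightarrow> (nat \<Rightarrow> nat \<Rightarrow> 'a mat) \<Rightarrow> 'a mat" where
  "block_matrix R C p q F =
     mat (R * p) (C * q) (\<lambda>(a, b). F (a div p) (b div q) $$ (a mod p, b mod q))"

definition const_matpoly :: "complex mat \<Rightarrow> complex poly mat" where
  "const_matpoly X = map_mat (\<lambda>c. [:c:]) X"

definition K1_newton :: "nat \<Rightarrow> nat \<Rightarrow> nat \<Rightarrow> (nat \<Rightarrow> complex) \<Rightarrow> complex poly mat" where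
  "K1_newton k \<mu> n x = block_matrix (k - \<mu> - 1) (k - \<mu>) n n
     (\<lambda>i j. if j = i then - 1\<^sub>m n
            else if j = i + 1 then node_factor x (k - 1 - i) \<cdot>\<^sub>m 1\<^sub>m n
            else 0\<^sub>m n n)"

definition K2_newton :: "nat \<Rightarrow> nat \<Rightarrow> (nat \<Rightarrow> complex) \<Rightarrow> complex poly mat" where
  "K2_newton \<mu> m x = block_matrix \<mu> (\<mu> + 1) m m
     (\<lambda>i j. if j = i then - 1\<^sub>m m
            else if j = i + 1 then node_factor x (\<mu> - i) \<cdot>\<^sub>m 1\<^sub>m m
            else 0\<^sub>m m m)"

text \<open>
  For \<open>\<mu> = k - 1\<close> the last block column \<open>k - \<mu> - 1\<close> is also the first one, and the formula
  yields the single block column \<open>\<gamma>\<^sub>k P\<^sub>k + P\<^sub>k\<^sub>-\<^sub>1, P\<^sub>k\<^sub>-\<^sub>2, \<dots>, P\<^sub>0\<close>.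
\<close>

definition M_newton ::
  "nat \<Rightarrow> nat \<Rightarrow> nat \<Rightarrow> nat \<Rightarrow> (nat \<Rightarrow> complex) \<Rightarrow> (nat \<Rightarrow> complex mat) \<Rightarrow> complex poly mat" where
  "M_newton k \<mu> m n x P = block_matrix (\<mu> + 1) (k - \<mu>) m n
     (\<lambda>i j. if i = 0 \<and> j = 0
              then node_factor x k \<cdot>\<^sub>m const_matpoly (P k) + const_matpoly (P (k - 1))
            else if i = 0 then const_matpoly (P (k - 1 - j))
            else if j = k - \<mu> - 1 then const_matpoly (P (\<mu> - i))
            else 0\<^sub>m m n)"

definition N_newton ::
  "nat \<Rightarrow> nat \<Rightarrow> nat \<Rightarrow> nat \<Rightarrow> (nat \<Rightarrow> complex) \<Rightarrow> (nat \<Rightarrow> complex mat) \<Rightarrow>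
     complex mat \<Rightarrow> complex mat \<Rightarrow> complex poly mat" where
  "N_newton k \<mu> m n x P A B =
     four_block_mat
       (M_newton k \<mu> m n x P + const_matpoly A * K1_newton k \<mu> n x
          + transpose_mat (K2_newton \<mu> m x) * const_matpoly B)
       (transpose_mat (K2_newton \<mu> m x))
       (K1_newton k \<mu> n x)
       (0\<^sub>m ((k - \<mu> - 1) * n) (\<mu> * m))"

end

theory Submission
  imports Defs
begin

text \<open>
  The pencil and its reversal are both instances of one homogeneous construction in which the linear
  factors \<open>\<gamma>\<^sub>l\<close> and the constant \<open>1\<close> are replaced by ring elements \<open>\<beta>\<^sub>l\<close> and \<open>a\<close>, where \<open>a\<close> is comaximal
  with every \<open>\<beta>\<^sub>l\<close> with \<open>l < k\<close>. The bidiagonal block \<open>K\<close> with rows \<open>(-a, b\<^sub>i)\<close> then kills the column \<open>\<Lambda>\<close> with entries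
  \<open>a\<^sup>i b\<^sub>i \<cdots> b\<^sub>d\<^sub>-\<^sub>1\<close>, and by comaximality it has a right inverse \<open>X\<close> while \<open>\<Lambda>\<close> has a left inverse \<open>W\<close>;
  replacing \<open>X\<close> by \<open>X - \<Lambda>WX\<close> makes \<open>(X, \<Lambda>)\<close> the inverse of \<open>K\<close> stacked on \<open>W\<close>. Doing this for \<open>K\<^sub>1\<close> and
  \<open>K\<^sub>2\<close>, block elimination reduces the pencil to \<open>diag(I, \<Lambda>\<^sub>2\<^sup>T M \<Lambda>\<^sub>1)\<close>, since the terms with \<open>A\<close> and \<open>B\<close> are
  annihilated, and \<open>\<Lambda>\<^sub>2\<^sup>T M \<Lambda>\<^sub>1\<close> is \<open>\<Sum>\<^sub>i a\<^sup>k\<^sup>-\<^sup>i \<beta>\<^sub>1 \<cdots> \<beta>\<^sub>i P\<^sub>i\<close>.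
\<close>

subsection \<open>Elimination in two-by-two block pencils\<close>

text \<open>Encoded as a four-block matrix with an empty lower block row, so that every product of
  block rows and block columns is an instance of \<open>mult_four_block_mat\<close>.\<close>

definition append_cols :: "'a::zero mat \<Rightarrow> 'a mat \<Rightarrow> 'a mat" where
  "append_cols A B = four_block_mat A B (0\<^sub>m 0 (dim_col A)) (0\<^sub>m 0 (dim_col B))"

lemma append_cols_carrier [simp, intro]:
  "A \<in> carrier_mat r c1 \<Longrightarrow> B \<in> carrier_mat r c2 \<Longrightarrow> append_cols A B \<in> carrier_mat r (c1 + c2)"
  by (auto simp: append_cols_def)

text \<open>A matrix without columns has no entries. This identifies the padding blocks that
  unfolding \<open>append_rows\<close> leaves behind.\<close>

lemma four_block_mat_cong_empty_cols:
  assumes "B \<in> carrier_mat r1 0" "B' \<in> carrier_mat r1 0" "D \<in> carrier_mat r2 0" "D' \<in> carrier_mat r2 0"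
  shows "four_block_mat A B C D = four_block_mat A B' C D'"
proof -
  have "B = B'" "D = D'" using assms by (auto intro!: eq_matI)
  then show ?thesis by simp
qed

lemma append_rows_mult_append_cols:
  fixes A B C D :: "'a::comm_ring_1 mat"
  assumes "A \<in> carrier_mat r1 l" "B \<in> carrier_mat r2 l" "C \<in> carrier_mat l c1" "D \<in> carrier_mat l c2"
  shows "(A @\<^sub>r B) * append_cols C D = four_block_mat (A * C) (A * D) (B * C) (B * D)"
  unfolding append_rows_def append_cols_def
  by (subst mult_four_block_mat[of _ r1 l _ 0 _ r2 _ _ c1 _ c2]) (use assms in auto)

lemma mult_append_cols:
  fixes A B C :: "'a::comm_ring_1 mat"
  assumes "C \<in> carrier_mat r l" "A \<in> carrier_mat l c1" "B \<in> carrier_mat l c2"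
  shows "C * append_cols A B = append_cols (C * A) (C * B)"
proof (rule eq_matI)
  fix i j
  assume "i < dim_row (append_cols (C * A) (C * B))" "j < dim_col (append_cols (C * A) (C * B))"
  then have ij: "i < r" "j < c1 + c2" using assms by (auto simp: append_cols_def)
  then have "col (append_cols A B) j = (if j < c1 then col A j else col B (j - c1))"
    using assms by (intro eq_vecI) (auto simp: append_cols_def)
  with ij show "(C * append_cols A B) $$ (i, j) = append_cols (C * A) (C * B) $$ (i, j)"
    using assms by (auto simp: append_cols_def)
qed (use assms in \<open>auto simp: append_cols_def\<close>)

lemma append_cols_mult_append_rows:
  fixes A B C D :: "'a::comm_ring_1 mat"
  assumes "A \<in> carrier_mat r l1" "B \<in> carrier_mat r l2" "C \<in> carrier_mat l1 c" "D \<in> carrier_mat l2 c"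
  shows "append_cols A B * (C @\<^sub>r D) = A * C + B * D"
  unfolding append_rows_def append_cols_def
  by (subst mult_four_block_mat[of _ r l1 _ l2 _ 0 _ _ c _ 0]) (use assms in \<open>auto intro!: eq_matI\<close>)

lemma four_block_mult_append_rows:
  fixes A B C D E F :: "'a::comm_ring_1 mat"
  assumes "A \<in> carrier_mat r1 l1" "B \<in> carrier_mat r1 l2" "C \<in> carrier_mat r2 l1" "D \<in> carrier_mat r2 l2"
    and "E \<in> carrier_mat l1 c" "F \<in> carrier_mat l2 c"
  shows "four_block_mat A B C D * (E @\<^sub>r F) = (A * E + B * F) @\<^sub>r (C * E + D * F)"
  unfolding append_rows_def
  by (subst mult_four_block_mat[of _ r1 l1 _ l2 _ r2 _ _ c _ 0])
     (use assms in \<open>auto intro!: four_block_mat_cong_empty_cols\<close>)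

lemma append_cols_mult_four_block:
  fixes A B C D E F :: "'a::comm_ring_1 mat"
  assumes "E \<in> carrier_mat r l1" "F \<in> carrier_mat r l2"
    and "A \<in> carrier_mat l1 c1" "B \<in> carrier_mat l1 c2" "C \<in> carrier_mat l2 c1" "D \<in> carrier_mat l2 c2"
  shows "append_cols E F * four_block_mat A B C D = append_cols (E * A + F * C) (E * B + F * D)"
  unfolding append_cols_def
  by (subst mult_four_block_mat[of _ r l1 _ l2 _ 0 _ _ c1 _ c2]) (use assms in \<open>auto intro!: cong_four_block_mat eq_matI\<close>)

lemma append_rows_zero:
  "(0\<^sub>m r1 c @\<^sub>r 0\<^sub>m r2 c) = 0\<^sub>m (r1 + r2) c"
  by (rule eq_matI) (auto simp: append_rows_def)

lemma append_cols_zero: "append_cols (0\<^sub>m r c1) (0\<^sub>m r c2) = 0\<^sub>m r (c1 + c2)"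
  by (rule eq_matI) (auto simp: append_cols_def)

text \<open>The two determinants multiply to 1, hence are units of the polynomial ring, that is,
  nonzero constants. Unimodularity thus follows from exhibiting an inverse, without expanding a
  determinant.\<close>

lemma unimodular_if_invertible:
  assumes "U \<in> carrier_mat N N" "V \<in> carrier_mat N N" "U * V = 1\<^sub>m N"
  shows "unimodular U" "unimodular V"
proof -
  have "det U * det V = 1"
    using det_mult[OF assms(1,2)] assms(3) by simp
  then have "is_unit (det U)" "is_unit (det V)"
    by (metis dvd_triv_left, metis dvd_triv_right)
  then show "unimodular U" "unimodular V"
    using assms by (auto simp: unimodular_def is_unit_poly_iff)
qed

lemma uminus_add_self_mat:
  fixes A :: "'a::ring_1 mat"
  assumes "A \<in> carrier_mat r c"
  shows "A + - A = 0\<^sub>m r c"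
  by (rule eq_matI) (use assms in auto)

text \<open>
  Here \<open>(L, X)\<close> is a basis dual to the rows \<open>(W, K)\<close>, and \<open>(F, E)\<close> is one dual to the columns \<open>(G, J)\<close>.
  Both transformations are block triangular up to a permutation of the blocks, and their inverses
  are written down explicitly.
\<close>

lemma dual_completion_linearization:
  fixes M K J :: "complex poly mat"
  assumes M: "M \<in> carrier_mat (q + m) (p + n)"
    and K: "K \<in> carrier_mat p (p + n)" and X: "X \<in> carrier_mat (p + n) p"
    and L: "L \<in> carrier_mat (p + n) n" and W: "W \<in> carrier_mat n (p + n)"
    and KX: "K * X = 1\<^sub>m p" and KL: "K * L = 0\<^sub>m p n" and WX: "W * X = 0\<^sub>m n p" and WL: "W * L = 1\<^sub>m n"
    and J: "J \<in> carrier_mat (q + m) q" and E: "E \<in> carrier_mat q (q + m)"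
    and F: "F \<in> carrier_mat m (q + m)" and G: "G \<in> carrier_mat (q + m) m"
    and EJ: "E * J = 1\<^sub>m q" and FJ: "F * J = 0\<^sub>m m q" and EG: "E * G = 0\<^sub>m q m" and FG: "F * G = 1\<^sub>m m"
    and P: "F * M * L = P"
    and grade: "has_grade 1 (four_block_mat M J K (0\<^sub>m p q))"
  shows "is_linearization (four_block_mat M J K (0\<^sub>m p q)) P"
proof -
  \<comment> \<open>Since \<open>E * J\<close> is the identity, \<open>Y\<close> and
    \<open>T\<close> are chosen to make \<open>E\<close> annihilate \<open>M * X + J * Y\<close> and
    \<open>M * L + J * T\<close>; \<open>S\<close> then cancels \<open>F * M * X\<close> in the last
    block row.\<close>
  define Y where "Y = - (E * M * X)"
  define T where "T = - (E * M * L)"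
  define S where "S = - (F * M * X)"
  define U1 where "U1 = four_block_mat (0\<^sub>m p (q + m)) (1\<^sub>m p) E (0\<^sub>m q p)"
  define U2 where "U2 = append_cols F S"
  define V1 where "V1 = four_block_mat X (0\<^sub>m (p + n) q) Y (1\<^sub>m q)"
  define V2 where "V2 = L @\<^sub>r T"
  define H where "H = four_block_mat M J K (0\<^sub>m p q)"
  have Y: "Y \<in> carrier_mat q p" and T: "T \<in> carrier_mat q n" and S: "S \<in> carrier_mat m p"
    using assms by (auto simp: Y_def T_def S_def)
  have U1: "U1 \<in> carrier_mat (p + q) (q + m + p)" and U2: "U2 \<in> carrier_mat m (q + m + p)"
    and V1: "V1 \<in> carrier_mat (p + n + q) (p + q)" and V2: "V2 \<in> carrier_mat (p + n + q) n"
    and H: "H \<in> carrier_mat (q + m + p) (p + n + q)"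
    using assms Y T S by (auto simp: U1_def U2_def V1_def V2_def H_def)
  have FM: "F * M \<in> carrier_mat m (p + n)" using F M by auto
  have EMX: "E * M * X \<in> carrier_mat q p" and EML: "E * M * L \<in> carrier_mat q n"
    and FMX: "F * M * X \<in> carrier_mat m p" and MX: "M * X \<in> carrier_mat (q + m) p"
    and MLm: "M * L \<in> carrier_mat (q + m) n" and EM: "E * M \<in> carrier_mat q (p + n)"
    using assms by auto
  have JY: "J * Y \<in> carrier_mat (q + m) p" and JT: "J * T \<in> carrier_mat (q + m) n"
    using J Y T by auto
  have MXJY: "M * X + J * Y \<in> carrier_mat (q + m) p" and MLJT: "M * L + J * T \<in> carrier_mat (q + m) n"
    using JY JT by auto
  have eq: "E * (M * X + J * Y) = 0\<^sub>m q p" "E * (M * L + J * T) = 0\<^sub>m q n"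
    "F * (M * X + J * Y) = F * M * X" "F * (M * L + J * T) = P"
    subgoal
      by (simp add: mult_add_distrib_mat[OF E MX JY] assoc_mult_mat[OF E J Y, symmetric] EJ
          assoc_mult_mat[OF E M X, symmetric] left_mult_one_mat[OF Y])
         (simp add: Y_def uminus_add_self_mat[OF EMX])
    subgoal
      by (simp add: mult_add_distrib_mat[OF E MLm JT] assoc_mult_mat[OF E J T, symmetric] EJ
          assoc_mult_mat[OF E M L, symmetric] left_mult_one_mat[OF T])
         (simp add: T_def uminus_add_self_mat[OF EML])
    subgoal
      using FMX by (simp add: mult_add_distrib_mat[OF F MX JY] assoc_mult_mat[OF F J Y, symmetric] FJ
          assoc_mult_mat[OF F M X, symmetric] left_mult_zero_mat[OF Y] del: assoc_mult_mat)
    subgoal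
      using mult_carrier_mat[OF FM L] by (simp add: mult_add_distrib_mat[OF F MLm JT] assoc_mult_mat[OF F J T, symmetric] FJ
          assoc_mult_mat[OF F M L, symmetric] left_mult_zero_mat[OF T] P[symmetric] del: assoc_mult_mat)
    done
  have HV1: "H * V1 = four_block_mat (M * X + J * Y) J (1\<^sub>m p) (0\<^sub>m p q)"
    unfolding H_def V1_def
    by (subst mult_four_block_mat[OF M J K zero_carrier_mat X zero_carrier_mat Y one_carrier_mat])
       (use M J K X Y KX in auto)
  have HV2: "H * V2 = (M * L + J * T) @\<^sub>r 0\<^sub>m p n"
    unfolding H_def V2_def
    by (subst four_block_mult_append_rows[OF M J K zero_carrier_mat L T]) (use T KL in auto)
  have "U1 * (H * V1) = four_block_mat (1\<^sub>m p) (0\<^sub>m p q) (0\<^sub>m q p) (1\<^sub>m q)"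
    unfolding HV1 U1_def
    by (subst mult_four_block_mat[of _ p "q+m" _ p _ q _ _ p _ q]) (use E J MXJY eq EJ left_mult_zero_mat[OF MXJY] in auto)
  then have 11: "U1 * (H * V1) = 1\<^sub>m (p + q)" by simp
  have "U1 * (H * V2) = 0\<^sub>m p n @\<^sub>r 0\<^sub>m q n"
    unfolding HV2 U1_def
    by (subst four_block_mult_append_rows[of _ p "q+m" _ p _ q _ _ n]) (use E MLJT eq left_mult_zero_mat[OF MLJT] in auto)
  then have 12: "U1 * (H * V2) = 0\<^sub>m (p + q) n" by (simp add: append_rows_zero)
  have FMXS: "F * (M * X + J * Y) + S = 0\<^sub>m m p"
    unfolding eq(3) S_def by (rule uminus_add_self_mat[OF FMX])
  have "U2 * (H * V1) = append_cols (0\<^sub>m m p) (0\<^sub>m m q)"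
    unfolding HV1 U2_def
    by (subst append_cols_mult_four_block[OF F S MXJY J one_carrier_mat zero_carrier_mat])
       (use FMXS FJ S in simp)
  then have 21: "U2 * (H * V1) = 0\<^sub>m m (p + q)" by (simp add: append_cols_zero)
  have Pc: "P \<in> carrier_mat m n" using P mult_carrier_mat[OF FM L] by simp
  have 22: "U2 * (H * V2) = P"
    unfolding HV2 U2_def
    by (subst append_cols_mult_append_rows[OF F S MLJT zero_carrier_mat])
       (use S Pc eq(4) in simp)
  have dP: "dim_row P = m" "dim_col P = n" using Pc by auto
  have "(U1 @\<^sub>r U2) * H * append_cols V1 V2 = (U1 @\<^sub>r U2) * append_cols (H * V1) (H * V2)"
    using assoc_mult_mat[OF carrier_append_rows[OF U1 U2] H append_cols_carrier[OF V1 V2]]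
    by (simp add: mult_append_cols[OF H V1 V2])
  also have "\<dots> = four_block_mat (1\<^sub>m (p + q)) (0\<^sub>m (p + q) n) (0\<^sub>m m (p + q)) P"
    by (subst append_rows_mult_append_cols[OF U1 U2]) (use H V1 V2 11 12 21 22 in auto)
  finally have main: "(U1 @\<^sub>r U2) * H * append_cols V1 V2 = 
    four_block_mat (1\<^sub>m (p + q)) (0\<^sub>m (p + q) (dim_col P)) (0\<^sub>m (dim_row P) (p + q)) P"
    by (simp add: dP)

  \<comment> \<open>\<open>Z1\<close> stacked on \<open>Z2\<close> is the inverse of the column
    transformation: \<open>K\<close> and \<open>W\<close> are dual to \<open>X\<close> and
    \<open>L\<close>, and the entry \<open>E * M\<close> undoes \<open>Y\<close> and
    \<open>T\<close>.\<close>
  define Z1 where "Z1 = four_block_mat K (0\<^sub>m p q) (E * M) (1\<^sub>m q)"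
  define Z2 where "Z2 = append_cols W (0\<^sub>m n q)"
  have Z1: "Z1 \<in> carrier_mat (p + q) (p + n + q)" and Z2: "Z2 \<in> carrier_mat n (p + n + q)"
    using K E M W by (auto simp: Z1_def Z2_def)
  have EMXY: "E * M * X + Y = 0\<^sub>m q p" and EMLT: "E * M * L + T = 0\<^sub>m q n"
    unfolding Y_def T_def by (rule uminus_add_self_mat[OF EMX], rule uminus_add_self_mat[OF EML])
  have "Z1 * V1 = four_block_mat (1\<^sub>m p) (0\<^sub>m p q) (0\<^sub>m q p) (1\<^sub>m q)"
    unfolding Z1_def V1_def
    by (subst mult_four_block_mat[OF K zero_carrier_mat EM one_carrier_mat X zero_carrier_mat Y one_carrier_mat])
       (use Y KX EMXY right_mult_zero_mat[OF EM] right_mult_zero_mat[OF K] in auto)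
  then have z11: "Z1 * V1 = 1\<^sub>m (p + q)" by simp
  have "Z1 * V2 = 0\<^sub>m p n @\<^sub>r 0\<^sub>m q n"
    unfolding Z1_def V2_def
    by (subst four_block_mult_append_rows[OF K zero_carrier_mat EM one_carrier_mat L T])
       (use T KL EMLT in auto)
  then have z12: "Z1 * V2 = 0\<^sub>m (p + q) n" by (simp add: append_rows_zero)
  have "Z2 * V1 = append_cols (0\<^sub>m n p) (0\<^sub>m n q)"
    unfolding Z2_def V1_def
    by (subst append_cols_mult_four_block[OF W zero_carrier_mat X zero_carrier_mat Y one_carrier_mat])
       (use W X Y WX in auto)
  then have z21: "Z2 * V1 = 0\<^sub>m n (p + q)" by (simp add: append_cols_zero)
  have z22: "Z2 * V2 = 1\<^sub>m n"
    unfolding Z2_def V2_def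
    by (subst append_cols_mult_append_rows[OF W zero_carrier_mat L T]) (use W L T WL in auto)
  have "(Z1 @\<^sub>r Z2) * append_cols V1 V2 = 1\<^sub>m (p + q + n)"
    by (subst append_rows_mult_append_cols[OF Z1 Z2 V1 V2]) (simp add: z11 z12 z21 z22)
  then have uV: "unimodular (append_cols V1 V2)"
    using carrier_append_rows[OF Z1 Z2] append_cols_carrier[OF V1 V2]
    by (intro unimodular_if_invertible(2)[of "Z1 @\<^sub>r Z2" "p + q + n"]) (simp_all add: add.commute add.left_commute)

  \<comment> \<open>\<open>R1\<close> next to \<open>R2\<close> is the inverse of the row
    transformation: \<open>J\<close> and \<open>G\<close> are dual to \<open>E\<close> and
    \<open>F\<close>, and \<open>- (G * S)\<close> compensates for the entry
    \<open>S\<close>.\<close>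
  define R1 where "R1 = four_block_mat (- (G * S)) J (1\<^sub>m p) (0\<^sub>m p q)"
  define R2 where "R2 = G @\<^sub>r 0\<^sub>m p m"
  have GS: "- (G * S) \<in> carrier_mat (q + m) p" using G S by auto
  have R1: "R1 \<in> carrier_mat (q + m + p) (p + q)" and R2: "R2 \<in> carrier_mat (q + m + p) m"
    using J G GS by (auto simp: R1_def R2_def)
  have EGS: "E * - (G * S) = 0\<^sub>m q p" and FGS: "F * - (G * S) = - S"
    using uminus_mult_right_mat[of E "G * S"] uminus_mult_right_mat[of F "G * S"]
      assoc_mult_mat[OF E G S, symmetric] assoc_mult_mat[OF F G S, symmetric] E F G S EG FG
      uminus_l_inv_mat[OF zero_carrier_mat[of q p]] by (simp_all add: eq_matI)
  have "U1 * R1 = four_block_mat (1\<^sub>m p) (0\<^sub>m p q) (0\<^sub>m q p) (1\<^sub>m q)"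
    unfolding U1_def R1_def
    by (subst mult_four_block_mat[OF zero_carrier_mat one_carrier_mat E zero_carrier_mat GS J one_carrier_mat zero_carrier_mat])
       (use E J EGS EJ left_mult_zero_mat[OF GS] left_mult_zero_mat[OF J] in simp)
  then have r11: "U1 * R1 = 1\<^sub>m (p + q)" by simp
  have "U1 * R2 = 0\<^sub>m p m @\<^sub>r 0\<^sub>m q m"
    unfolding U1_def R2_def
    by (subst four_block_mult_append_rows[OF zero_carrier_mat one_carrier_mat E zero_carrier_mat G zero_carrier_mat])
       (use E G EG in auto)
  then have r12: "U1 * R2 = 0\<^sub>m (p + q) m" by (simp add: append_rows_zero)
  have SS: "- S + S = 0\<^sub>m m p" using S by (rule uminus_l_inv_mat)
  have "U2 * R1 = append_cols (0\<^sub>m m p) (0\<^sub>m m q)"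
    unfolding U2_def R1_def
    by (subst append_cols_mult_four_block[OF F S GS J one_carrier_mat zero_carrier_mat])
       (use S FGS FJ SS in simp)
  then have r21: "U2 * R1 = 0\<^sub>m m (p + q)" by (simp add: append_cols_zero)
  have r22: "U2 * R2 = 1\<^sub>m m"
    unfolding U2_def R2_def
    by (subst append_cols_mult_append_rows[OF F S G zero_carrier_mat]) (use S FG in simp)
  have "(U1 @\<^sub>r U2) * append_cols R1 R2 = 1\<^sub>m (p + q + m)"
    by (subst append_rows_mult_append_cols[OF U1 U2 R1 R2]) (simp add: r11 r12 r21 r22)
  then have uU: "unimodular (U1 @\<^sub>r U2)"
    using carrier_append_rows[OF U1 U2] append_cols_carrier[OF R1 R2]
    by (intro unimodular_if_invertible(1)[of _ "p + q + m" "append_cols R1 R2"]) (simp_all add: add.commute add.left_commute)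
  have dims: "dim_row (U1 @\<^sub>r U2) = dim_row H" "dim_row (append_cols V1 V2) = dim_col H"
    using H U1 U2 V1 V2 by (auto simp: append_cols_def append_rows_def)
  show ?thesis
    unfolding is_linearization_def using grade uU uV dims main unfolding H_def by blast
qed

subsection \<open>Bidiagonal matrices over comaximal elements\<close>

definition comaximal :: "'a::comm_ring_1 \<Rightarrow> 'a \<Rightarrow> bool" where
  "comaximal a b \<longleftrightarrow> (\<exists>u v. u * a + v * b = 1)"

lemma comaximal_commute: "comaximal a b \<longleftrightarrow> comaximal b a"
  unfolding comaximal_def by (metis add.commute)

lemma comaximal_one_right: "comaximal a 1"
  unfolding comaximal_def by (rule exI[of _ 0], rule exI[of _ 1]) simp

lemma comaximal_mult_right:
  assumes "comaximal a b" "comaximal a c"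
  shows "comaximal a (b * c)"
proof -
  from assms obtain u v u' v' where 1: "u * a + v * b = 1" and 2: "u' * a + v' * c = 1"
    unfolding comaximal_def by blast
  \<comment> \<open>The product of the two Bezout identities, collected into a multiple of
    \<open>a\<close> and a multiple of \<open>b * c\<close>.\<close>
  have "(u * u' * a + u * v' * c + v * b * u') * a + (v * v') * (b * c) = (u * a + v * b) * (u' * a + v' * c)"
    by (simp add: algebra_simps)
  then show ?thesis unfolding comaximal_def 1 2 by (metis mult_1)
qed

lemma comaximal_prod_right:
  "(\<And>i. i \<in> I \<Longrightarrow> comaximal a (b i)) \<Longrightarrow> comaximal a (\<Prod>i\<in>I. b i)"
  by (induction I rule: infinite_finite_induct) (auto intro: comaximal_one_right comaximal_mult_right)

lemma comaximal_power_left: "comaximal a b \<Longrightarrow> comaximal (a ^ e) b"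
  by (induction e) (auto simp: comaximal_commute[of _ b] intro: comaximal_one_right comaximal_mult_right)

text \<open>The scalar skeleton of \<open>K1_newton\<close> and \<open>K2_newton\<close>: the case
  of block size 1, with the constant 1 homogenised to \<open>a\<close>.\<close>

definition chain_mat :: "'a::comm_ring_1 \<Rightarrow> (nat \<Rightarrow> 'a) \<Rightarrow> nat \<Rightarrow> 'a mat" where
  "chain_mat a b d = mat d (d + 1) (\<lambda>(i, j). if j = i then - a else if j = i + 1 then b i else 0)"

text \<open>For \<open>a = 1\<close> and \<open>b i = node_factor x (d - i)\<close> the entries are
  \<open>newton_poly x (d - i)\<close>.\<close>

definition chain_kernel :: "'a::comm_ring_1 \<Rightarrow> (nat \<Rightarrow> 'a) \<Rightarrow> nat \<Rightarrow> 'a mat" where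
  "chain_kernel a b d = mat (d + 1) 1 (\<lambda>(i, j). a ^ i * (\<Prod>t\<in>{i..<d}. b t))"

lemma chain_mat_carrier [simp]: "chain_mat a b d \<in> carrier_mat d (d + 1)"
  by (simp add: chain_mat_def)

lemma chain_kernel_carrier [simp]: "chain_kernel a b d \<in> carrier_mat (d + 1) 1"
  by (simp add: chain_kernel_def)

lemma chain_mat_mult_index:
  assumes "C \<in> carrier_mat (d + 1) c" "i < d" "j < c"
  shows "(chain_mat a b d * C) $$ (i, j) = - a * C $$ (i, j) + b i * C $$ (i + 1, j)"
proof -
  have "(chain_mat a b d * C) $$ (i, j) =
      (\<Sum>t\<in>{0..<d + 1}. (if t = i then - a else if t = i + 1 then b i else 0) * C $$ (t, j))"
    using assms by (simp add: chain_mat_def scalar_prod_def)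
  also have "\<dots> = (\<Sum>t\<in>{i, i + 1}. (if t = i then - a else if t = i + 1 then b i else 0) * C $$ (t, j))"
    using assms by (intro sum.mono_neutral_right) auto
  finally show ?thesis by simp
qed

text \<open>Both terms of row \<open>i\<close> equal
  \<open>a ^ (i + 1) * b i * ... * b (d - 1)\<close> up to sign, as splitting off the factor
  \<open>b i\<close> shows.\<close>

lemma chain_mat_mult_kernel: "chain_mat a b d * chain_kernel a b d = 0\<^sub>m d 1"
proof (rule eq_matI)
  fix i j :: nat
  assume "i < dim_row (0\<^sub>m d 1)" "j < dim_col (0\<^sub>m d 1)"
  moreover from this have "{i..<d} = insert i {i + 1..<d}" by auto
  ultimately show "(chain_mat a b d * chain_kernel a b d) $$ (i, j) = 0\<^sub>m d 1 $$ (i, j)"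
    by (subst chain_mat_mult_index[OF chain_kernel_carrier]) (auto simp: chain_kernel_def)
qed (auto simp: chain_mat_def chain_kernel_def)

lemma chain_mat_right_inverse:
  assumes "\<And>i. i < d \<Longrightarrow> comaximal a (b i)"
  obtains X where "X \<in> carrier_mat (d + 1) d" "chain_mat a b d * X = 1\<^sub>m d"
proof -
  have "\<exists>u v. u * a ^ (j + 1) + v * (\<Prod>t\<in>{j..<d}. b t) = 1" for j
    unfolding comaximal_def[symmetric]
    by (intro comaximal_power_left comaximal_prod_right) (auto intro: assms)
  then obtain u v where uv: "\<And>j. u j * a ^ (j + 1) + v j * (\<Prod>t\<in>{j..<d}. b t) = 1" by metis
  \<comment> \<open>Column \<open>j\<close> solves the rows above \<open>j\<close> upwards and those below \<open>j\<close> downwards; the Bezout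
    coefficients for \<open>a ^ (j + 1)\<close> and \<open>b j \<cdots> b (d - 1)\<close> make row \<open>j\<close> itself equal to 1.\<close>
  define X where "X = mat (d + 1) d (\<lambda>(i, j). if i \<le> j then - u j * a ^ i * (\<Prod>t\<in>{i..<j}. b t)
    else v j * a ^ (i - j - 1) * (\<Prod>t\<in>{i..<d}. b t))"
  have X: "X \<in> carrier_mat (d + 1) d" by (simp add: X_def)
  have "chain_mat a b d * X = 1\<^sub>m d"
  proof (rule eq_matI)
    fix i j :: nat
    assume "i < dim_row (1\<^sub>m d)" "j < dim_col (1\<^sub>m d)"
    then have ij: "i < d" "j < d" by auto
    have split: "{i..<e} = insert i {i + 1..<e}" if "i < e" for e using that by auto
    consider "i < j" | "i = j" | "j < i" by linarith
    then show "(chain_mat a b d * X) $$ (i, j) = 1\<^sub>m d $$ (i, j)"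
    proof cases
      case 1
      then show ?thesis
        using ij split[of j] by (subst chain_mat_mult_index[OF X ij]) (simp add: X_def algebra_simps)
    next
      case 2
      then show ?thesis
        using ij split[of d] uv[of j] by (subst chain_mat_mult_index[OF X ij]) (simp add: X_def algebra_simps)
    next
      case 3
      \<comment> \<open>Entries \<open>i\<close> and \<open>i + 1\<close> of column \<open>j\<close>
        carry consecutive powers of \<open>a\<close>; with one factor \<open>a\<close> split off,
        the two terms of the row cancel.\<close>
      then have "a ^ (i - j) = a * a ^ (i - j - 1)" by (simp add: Suc_diff_Suc flip: power_Suc)
      with 3 show ?thesis
        using ij split[of d] by (subst chain_mat_mult_index[OF X ij]) (simp add: X_def algebra_simps)
    qed
  qed (auto simp: X_def chain_mat_def)
  with X show thesis by (rule that)
qed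

text \<open>The first entry \<open>b 0 * ... * b (d - 1)\<close> and the last entry
  \<open>a ^ d\<close> of the kernel column are already comaximal, so a row supported on these two
  positions suffices.\<close>

lemma chain_kernel_left_inverse:
  assumes "\<And>i. i < d \<Longrightarrow> comaximal a (b i)"
  obtains W where "W \<in> carrier_mat 1 (d + 1)" "W * chain_kernel a b d = 1\<^sub>m 1"
proof -
  have "comaximal (a ^ d) (\<Prod>t\<in>{0..<d}. b t)"
    by (intro comaximal_power_left comaximal_prod_right) (auto intro: assms)
  then obtain u v where uv: "u * a ^ d + v * (\<Prod>t\<in>{0..<d}. b t) = 1"
    unfolding comaximal_def by blast
  \<comment> \<open>The two coefficients are added instead of separated by cases, because for
    \<open>d = 0\<close> both fall on the same entry.\<close>
  define W where "W = mat 1 (d + 1) (\<lambda>(i, j). (if j = 0 then v else 0) + (if j = d then u else 0))"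
  have "W * chain_kernel a b d = 1\<^sub>m 1"
  proof (rule eq_matI)
    fix i j :: nat
    assume "i < dim_row (1\<^sub>m 1)" "j < dim_col (1\<^sub>m 1)"
    then have "(W * chain_kernel a b d) $$ (i, j) =
        (\<Sum>t\<in>{0..<d + 1}. ((if t = 0 then v else 0) + (if t = d then u else 0)) * (a ^ t * (\<Prod>s\<in>{t..<d}. b s)))"
      by (simp add: W_def chain_kernel_def scalar_prod_def)
    also have "\<dots> = (\<Sum>t\<in>{0..<d + 1}. if t = 0 then v * (a ^ t * (\<Prod>s\<in>{t..<d}. b s)) else 0) +
        (\<Sum>t\<in>{0..<d + 1}. if t = d then u * (a ^ t * (\<Prod>s\<in>{t..<d}. b s)) else 0)"
      unfolding sum.distrib[symmetric] by (rule sum.cong) (auto simp: distrib_right)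
    also have "\<dots> = 1" unfolding sum.delta[OF finite_atLeastLessThan] using uv by (auto simp: add.commute)
    finally show "(W * chain_kernel a b d) $$ (i, j) = 1\<^sub>m 1 $$ (i, j)"
      using \<open>i < dim_row _\<close> \<open>j < dim_col _\<close> by simp
  qed (auto simp: W_def chain_kernel_def)
  moreover have "W \<in> carrier_mat 1 (d + 1)" by (simp add: W_def)
  ultimately show thesis using that by blast
qed

text \<open>Subtracting the kernel column times \<open>W * X\<close> from \<open>X\<close> does not
  change the product with the chain matrix, and it makes \<open>W * X\<close> vanish because
  \<open>W\<close> maps the kernel column to 1.\<close>

lemma chain_dual_completion:
  assumes "\<And>i. i < d \<Longrightarrow> comaximal a (b i)"
  obtains X W where "X \<in> carrier_mat (d + 1) d" "W \<in> carrier_mat 1 (d + 1)"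
    "chain_mat a b d * X = 1\<^sub>m d" "W * X = 0\<^sub>m 1 d" "W * chain_kernel a b d = 1\<^sub>m 1"
proof -
  let ?K = "chain_mat a b d" and ?L = "chain_kernel a b d"
  obtain X where X: "X \<in> carrier_mat (d + 1) d" "?K * X = 1\<^sub>m d"
    using chain_mat_right_inverse assms by blast
  obtain W where W: "W \<in> carrier_mat 1 (d + 1)" "W * ?L = 1\<^sub>m 1"
    using chain_kernel_left_inverse assms by blast
  have WX: "W * X \<in> carrier_mat 1 d" using X W by auto
  note LWX = mult_carrier_mat[OF chain_kernel_carrier WX]
  have "?K * (X - ?L * (W * X)) = 1\<^sub>m d - ?K * ?L * (W * X)"
    using mult_minus_distrib_mat[OF chain_mat_carrier X(1) LWX] X(2)
      assoc_mult_mat[OF chain_mat_carrier chain_kernel_carrier WX] by simp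
  then have 1: "?K * (X - ?L * (W * X)) = 1\<^sub>m d"
    unfolding chain_mat_mult_kernel left_mult_zero_mat[OF WX] by auto
  have "W * (X - ?L * (W * X)) = W * X - W * ?L * (W * X)"
    using mult_minus_distrib_mat[OF W(1) X(1) LWX] assoc_mult_mat[OF W(1) chain_kernel_carrier WX] by simp
  then have "W * (X - ?L * (W * X)) = 0\<^sub>m 1 d"
    by (simp only: W(2) left_mult_one_mat[OF WX] minus_r_inv_mat[OF WX])
  with 1 show thesis
    using that[of "X - ?L * (W * X)" W] X W minus_carrier_mat[OF LWX] by auto
qed

section \<open>Kronecker products with an identity matrix\<close>

text \<open>The Kronecker product of \<open>G\<close> with the identity of size \<open>n\<close>,
  written in terms of quotients and remainders of the indices.\<close>

definition kron_one :: "nat \<Rightarrow> 'a::comm_ring_1 mat \<Rightarrow> 'a mat" where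
  "kron_one n G = mat (dim_row G * n) (dim_col G * n)
     (\<lambda>(i, j). if i mod n = j mod n then G $$ (i div n, j div n) else 0)"

lemma kron_one_carrier [simp]:
  "G \<in> carrier_mat r c \<Longrightarrow> kron_one n G \<in> carrier_mat (r * n) (c * n)"
  by (simp add: kron_one_def)

lemma kron_one_transpose: "transpose_mat (kron_one n G) = kron_one n (transpose_mat G)"
  by (rule eq_matI) (auto simp: kron_one_def less_mult_imp_div_less)

lemma kron_one_zero: "kron_one n (0\<^sub>m r c) = 0\<^sub>m (r * n) (c * n)"
  by (rule eq_matI) (auto simp: kron_one_def less_mult_imp_div_less)

lemma kron_one_one: "kron_one n (1\<^sub>m r) = 1\<^sub>m (r * n)"
proof (rule eq_matI)
  fix i j :: nat
  assume *: "i < dim_row (1\<^sub>m (r * n))" "j < dim_col (1\<^sub>m (r * n))"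
  have "i = j \<longleftrightarrow> i div n = j div n \<and> i mod n = j mod n"
    by (metis div_mult_mod_eq)
  with * show "kron_one n (1\<^sub>m r) $$ (i, j) = 1\<^sub>m (r * n) $$ (i, j)"
    by (auto simp: kron_one_def less_mult_imp_div_less)
qed (auto simp: kron_one_def)

lemma sum_blocks:
  fixes f :: "nat \<Rightarrow> 'b::comm_monoid_add"
  shows "(\<Sum>c\<in>{0..<C * n}. f c) = (\<Sum>i\<in>{0..<C}. \<Sum>r\<in>{0..<n}. f (i * n + r))"
proof -
  have "(\<Sum>r\<in>{0..<n}. f (i * n + r)) = sum f {i * n..<i * n + n}" for i
    using sum.shift_bounds_nat_ivl[of f 0 "i * n" n] by (simp add: add.commute)
  then show ?thesis
    using sum.nat_group[of f n C] by (simp add: lessThan_atLeast0)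
qed

text \<open>In row \<open>i\<close> of the Kronecker product only columns congruent to
  \<open>i\<close> modulo \<open>n\<close> can be nonzero, so cutting the sum into blocks leaves one
  term per block.\<close>

lemma kron_one_mult_index:
  fixes G H :: "'a::comm_ring_1 mat"
  assumes "G \<in> carrier_mat r c" "H \<in> carrier_mat (c * n) e" "i < r * n" "j < e"
  shows "(kron_one n G * H) $$ (i, j) = (\<Sum>t\<in>{0..<c}. G $$ (i div n, t) * H $$ (t * n + i mod n, j))"
proof -
  have n: "n > 0" using assms by (cases n) auto
  have "(kron_one n G * H) $$ (i, j) = (\<Sum>s\<in>{0..<c * n}.
      (if i mod n = s mod n then G $$ (i div n, s div n) else 0) * H $$ (s, j))"
    using assms by (simp add: kron_one_def scalar_prod_def)
  also have "\<dots> = (\<Sum>t\<in>{0..<c}. \<Sum>s\<in>{0..<n}.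
      (if s = i mod n then G $$ (i div n, t) * H $$ (t * n + i mod n, j) else 0))"
    unfolding sum_blocks by (intro sum.cong refl) (use n in \<open>auto simp: div_mult_self3\<close>)
  also have "\<dots> = (\<Sum>t\<in>{0..<c}. G $$ (i div n, t) * H $$ (t * n + i mod n, j))"
    using n by (simp add: sum.delta)
  finally show ?thesis .
qed

text \<open>The mixed-product rule. It lifts all duality identities of the scalar chains to the
  block matrices.\<close>

lemma kron_one_mult:
  fixes G H :: "'a::comm_ring_1 mat"
  assumes "G \<in> carrier_mat r c" "H \<in> carrier_mat c e"
  shows "kron_one n G * kron_one n H = kron_one n (G * H)"
proof (rule eq_matI)
  fix i j :: nat
  assume "i < dim_row (kron_one n (G * H))" "j < dim_col (kron_one n (G * H))"
  then have ij: "i < r * n" "j < e * n" using assms by (auto simp: kron_one_def)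
  then have n: "n > 0" by (cases n) auto
  have bound: "t * n + i mod n < c * n" if "t < c" for t
    using that n mult_le_mono1[of "t + 1" c n] by (simp add: add.commute) 
      (metis add.commute add_less_mono1 mod_less_divisor order_less_le_trans)
  have "(kron_one n G * kron_one n H) $$ (i, j) =
      (\<Sum>t\<in>{0..<c}. G $$ (i div n, t) * kron_one n H $$ (t * n + i mod n, j))"
    by (rule kron_one_mult_index[OF assms(1) kron_one_carrier[OF assms(2)] ij])
  also have "\<dots> = (\<Sum>t\<in>{0..<c}. if i mod n = j mod n then G $$ (i div n, t) * H $$ (t, j div n) else 0)"
    using assms ij n bound by (intro sum.cong) (auto simp: kron_one_def div_mult_self3)
  also have "\<dots> = kron_one n (G * H) $$ (i, j)"
    using assms ij by (simp add: kron_one_def scalar_prod_def less_mult_imp_div_less)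
  finally show "(kron_one n G * kron_one n H) $$ (i, j) = kron_one n (G * H) $$ (i, j)" .
qed (use assms in \<open>auto simp: kron_one_def\<close>)

subsection \<open>Homogeneous pencils\<close>

text \<open>
  \<open>M_newton\<close> with \<open>\<gamma>\<^sub>l\<close> replaced by \<open>\<beta> l\<close> and homogenised by \<open>a\<close>: the pencil itself is the case \<open>a = 1\<close>,
  its reversal the case where \<open>a\<close> is the indeterminate and \<open>\<beta> l = 1 - x\<^sub>l a\<close>.
\<close>

definition homog_corner ::
  "'a::comm_ring_1 \<Rightarrow> (nat \<Rightarrow> 'a) \<Rightarrow> nat \<Rightarrow> nat \<Rightarrow> nat \<Rightarrow> nat \<Rightarrow> (nat \<Rightarrow> 'a mat) \<Rightarrow> 'a mat" where
  "homog_corner a \<beta> k \<mu> m n Q = block_matrix (\<mu> + 1) (k - \<mu>) m n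
     (\<lambda>i j. if i = 0 \<and> j = 0 then \<beta> k \<cdot>\<^sub>m Q k + a \<cdot>\<^sub>m Q (k - 1)
            else if i = 0 then a \<cdot>\<^sub>m Q (k - 1 - j)
            else if j = k - \<mu> - 1 then a \<cdot>\<^sub>m Q (\<mu> - i)
            else 0\<^sub>m m n)"

section \<open>Compressing the corner block to the matrix polynomial\<close>

lemma block_matrix_carrier [simp]: "block_matrix R C p q F \<in> carrier_mat (R * p) (C * q)"
  by (simp add: block_matrix_def)

lemma block_index_less:
  fixes t r C n :: nat
  assumes "t < C" "r < n"
  shows "t * n + r < C * n"
proof -
  have "t * n + r < (t + 1) * n" using assms by simp
  also have "\<dots> \<le> C * n" using assms by (intro mult_le_mono1) simp
  finally show ?thesis .
qed

lemma index_mult_mat_sum: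
  assumes "A \<in> carrier_mat r l" "B \<in> carrier_mat l c" "i < r" "j < c"
  shows "(A * B) $$ (i, j) = (\<Sum>t\<in>{0..<l}. A $$ (i, t) * B $$ (t, j))"
  using assms by (auto simp: scalar_prod_def)

text \<open>The outer factors consist of scalar multiples of identities, so the triple product
  combines whole blocks with scalar weights. This reduces the evaluation of the compressed corner to
  a double sum.\<close>

lemma kron_one_block_matrix_kron_one:
  fixes l r :: "'a::comm_ring_1 mat"
  assumes l: "l \<in> carrier_mat 1 R" and r: "r \<in> carrier_mat C 1" and "s < m" "t < n"
  shows "(kron_one m l * block_matrix R C m n F * kron_one n r) $$ (s, t) =
    (\<Sum>i<R. \<Sum>j<C. l $$ (0, i) * r $$ (j, 0) * F i j $$ (s, t))"
proof -
  let ?D = "block_matrix R C m n F"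
  have lD: "kron_one m l * ?D \<in> carrier_mat (1 * m) (C * n)"
    using mult_carrier_mat[OF kron_one_carrier[OF l] block_matrix_carrier] .
  have "(kron_one m l * ?D * kron_one n r) $$ (s, t) =
      (\<Sum>c\<in>{0..<C * n}. (kron_one m l * ?D) $$ (s, c) * kron_one n r $$ (c, t))"
    by (rule index_mult_mat_sum[OF lD kron_one_carrier[OF r]]) (use assms(3,4) in auto)
  also have "\<dots> = (\<Sum>j\<in>{0..<C}. \<Sum>e\<in>{0..<n}. if e = t then (kron_one m l * ?D) $$ (s, j * n + t) * r $$ (j, 0) else 0)"
    unfolding sum_blocks using r assms(4)
    by (intro sum.cong refl) (auto simp: kron_one_def block_index_less div_mult_self3)
  also have "\<dots> = (\<Sum>j\<in>{0..<C}. (kron_one m l * ?D) $$ (s, j * n + t) * r $$ (j, 0))"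
    using assms(4) by simp
  also have "\<dots> = (\<Sum>j\<in>{0..<C}. \<Sum>i\<in>{0..<R}. l $$ (0, i) * r $$ (j, 0) * F i j $$ (s, t))"
  proof (intro sum.cong refl)
    fix j assume j: "j \<in> {0..<C}"
    then have "(kron_one m l * ?D) $$ (s, j * n + t) =
        (\<Sum>i\<in>{0..<R}. l $$ (s div m, i) * ?D $$ (i * m + s mod m, j * n + t))"
      using assms by (intro kron_one_mult_index[OF l block_matrix_carrier]) (auto simp: block_index_less)
    also have "\<dots> = (\<Sum>i\<in>{0..<R}. l $$ (0, i) * F i j $$ (s, t))"
      using assms j by (intro sum.cong refl) (auto simp: block_matrix_def block_index_less div_mult_self3)
    finally show "(kron_one m l * ?D) $$ (s, j * n + t) * r $$ (j, 0) =
        (\<Sum>i\<in>{0..<R}. l $$ (0, i) * r $$ (j, 0) * F i j $$ (s, t))"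
      by (simp add: sum_distrib_left mult_ac)
  qed
  also have "\<dots> = (\<Sum>i<R. \<Sum>j<C. l $$ (0, i) * r $$ (j, 0) * F i j $$ (s, t))"
    by (subst sum.swap) (simp add: lessThan_atLeast0)
  finally show ?thesis .
qed

text \<open>The chains list their factors by decreasing index, the Newton products by increasing
  index. The offset \<open>h\<close> is \<open>\<mu>\<close> for \<open>K1\<close> and 0 for
  \<open>K2\<close>.\<close>

lemma prod_reverse_interval:
  fixes \<beta> :: "nat \<Rightarrow> 'a::comm_monoid_mult"
  assumes "i \<le> d"
  shows "(\<Prod>t\<in>{i..<d}. \<beta> (h + d - t)) = (\<Prod>l\<in>{h + 1..h + d - i}. \<beta> l)"
  by (rule prod.reindex_bij_witness[of _ "\<lambda>l. h + d - l" "\<lambda>t. h + d - t"]) (use assms in auto)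

text \<open>Each coefficient is met exactly once: the first block row yields the indices from
  \<open>\<mu>\<close> to \<open>k - 1\<close>, its corner also the index \<open>k\<close>, and the
  rest of the last block column the indices below \<open>\<mu>\<close>. The powers of
  \<open>a\<close> from both kernels and from the block add up to \<open>k - i\<close>.\<close>

lemma homog_corner_sum:
  fixes a :: "'a::comm_ring_1" and \<beta> c :: "nat \<Rightarrow> 'a"
  defines "\<pi> \<equiv> \<lambda>i. (\<Prod>l\<in>{1..i}. \<beta> l)"
  assumes \<mu>: "\<mu> + d + 1 = k"
  shows "(\<Sum>i<\<mu> + 1. \<Sum>j<d + 1. (a ^ i * \<pi> (\<mu> - i)) * (a ^ j * (\<Prod>l\<in>{\<mu> + 1..\<mu> + d - j}. \<beta> l)) *
      (if i = 0 \<and> j = 0 then \<beta> k * c k + a * c (k - 1) else if i = 0 then a * c (k - 1 - j)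
       else if j = d then a * c (\<mu> - i) else 0)) = (\<Sum>i\<le>k. a ^ (k - i) * \<pi> i * c i)"
  (is "(\<Sum>i<\<mu> + 1. \<Sum>j<d + 1. ?f i j) = _")
proof -
  \<comment> \<open>In the first block row the kernel of \<open>K2\<close> supplies the factors up
    to \<open>\<mu>\<close> and that of \<open>K1\<close> those beyond, so together they form one
    full product.\<close>
  have pi: "\<pi> \<mu> * (\<Prod>l\<in>{\<mu> + 1..\<mu> + e}. \<beta> l) = \<pi> (\<mu> + e)" for e
  proof (induction e)
    case (Suc e)
    have "{\<mu> + 1..\<mu> + Suc e} = insert (\<mu> + Suc e) {\<mu> + 1..\<mu> + e}" 
      "{1..\<mu> + Suc e} = insert (\<mu> + Suc e) {1..\<mu> + e}" by auto
    with Suc show ?case by (simp add: \<pi>_def algebra_simps)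
  qed simp
  let ?g = "\<lambda>i. a ^ (k - i) * \<pi> i * c i"
  have row0: "?f 0 j = ?g (\<mu> + (d - j)) + (if j = 0 then ?g k else 0)" if "j < d + 1" for j
  proof -
    have e: "k - (\<mu> + (d - j)) = j + 1" "\<mu> + d - j = \<mu> + (d - j)" "k - 1 - j = \<mu> + (d - j)" "k - 1 = \<mu> + d"
      using \<mu> that by auto
    have "\<pi> k = \<pi> (\<mu> + d) * \<beta> k" unfolding \<mu>[symmetric] \<pi>_def by simp
    then have "?g k = \<pi> (\<mu> + d) * \<beta> k * c k" by simp
    then show ?thesis
      using pi[of "d - j", symmetric] unfolding e by (auto simp: algebra_simps e)
  qed
  \<comment> \<open>Below the first block row only the column \<open>j = d\<close> survives, where
    the product from the kernel of \<open>K1\<close> is empty and just \<open>a ^ d\<close>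
    remains.\<close>
  have rows: "(\<Sum>j<d + 1. ?f (Suc i) j) = ?g (\<mu> - Suc i)" if "i < \<mu>" for i
  proof -
    have e: "k - (\<mu> - Suc i) = Suc i + d + 1" using \<mu> that by auto
    have "(\<Sum>j<d + 1. ?f (Suc i) j) = (\<Sum>j\<in>{d}. ?f (Suc i) j)"
      by (rule sum.mono_neutral_right) auto
    also have "\<dots> = ?g (\<mu> - Suc i)" unfolding e by (simp add: power_add algebra_simps)
    finally show ?thesis .
  qed
  have "(\<Sum>i<\<mu> + 1. \<Sum>j<d + 1. ?f i j) = (\<Sum>j<d + 1. ?f 0 j) + (\<Sum>i<\<mu>. \<Sum>j<d + 1. ?f (Suc i) j)"
    unfolding Suc_eq_plus1[symmetric] by (rule sum.lessThan_Suc_shift)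
  also have "(\<Sum>i<\<mu>. \<Sum>j<d + 1. ?f (Suc i) j) = (\<Sum>i<\<mu>. ?g (\<mu> - Suc i))"
    by (intro sum.cong refl rows) simp
  also have "\<dots> = (\<Sum>i<\<mu>. ?g i)" by (rule sum.nat_diff_reindex)
  also have "(\<Sum>j<d + 1. ?f 0 j) = (\<Sum>j<d + 1. ?g (\<mu> + (d - j)) + (if j = 0 then ?g k else 0))"
    by (intro sum.cong refl row0) simp
  also have "\<dots> = (\<Sum>j<d + 1. ?g (\<mu> + (d - j))) + ?g k"
    by (simp add: sum.distrib sum.delta)
  also have "(\<Sum>j<d + 1. ?g (\<mu> + (d - j))) = (\<Sum>i\<in>{\<mu>..<k}. ?g i)"
    by (rule sum.reindex_bij_witness[of _ "\<lambda>i. \<mu> + d - i" "\<lambda>j. \<mu> + (d - j)"]) (use \<mu> in auto)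
  finally have "(\<Sum>i<\<mu> + 1. \<Sum>j<d + 1. ?f i j) = (\<Sum>i<\<mu>. ?g i) + (\<Sum>i\<in>{\<mu>..<k}. ?g i) + ?g k"
    by (simp add: algebra_simps)
  also have "\<dots> = (\<Sum>i\<le>k. ?g i)"
    using sum.atLeastLessThan_concat[of 0 \<mu> k ?g] \<mu> by (simp add: lessThan_atLeast0 atMost_atLeast0 sum.atLeast0_lessThan_Suc flip: atLeastLessThanSuc_atLeastAtMost)
  finally show ?thesis .
qed

text \<open>The general elimination is applied to \<open>K1\<close> with its dual completion and to
  the transpose of \<open>K2\<close> with the transposed completion. The compression of the corner
  loses the terms with \<open>A\<close> and \<open>B\<close>, and what remains is evaluated by
  \<open>homog_corner_sum\<close>.\<close>

lemma homog_pencil_linearization: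
  fixes a :: "complex poly" and \<beta> :: "nat \<Rightarrow> complex poly" and Q :: "nat \<Rightarrow> complex poly mat"
  assumes \<mu>: "\<mu> + d + 1 = k" and com: "\<And>l. 1 \<le> l \<Longrightarrow> l < k \<Longrightarrow> comaximal a (\<beta> l)"
    and Q: "\<And>i. i \<le> k \<Longrightarrow> Q i \<in> carrier_mat m n"
    and A: "A \<in> carrier_mat ((\<mu> + 1) * m) (d * n)" and B: "B \<in> carrier_mat (\<mu> * m) ((d + 1) * n)"
    and K1: "K1 = kron_one n (chain_mat a (\<lambda>i. \<beta> (\<mu> + d - i)) d)"
    and K2: "K2 = kron_one m (chain_mat a (\<lambda>i. \<beta> (\<mu> - i)) \<mu>)"
    and L: "L = four_block_mat (homog_corner a \<beta> k \<mu> m n Q + A * K1 + transpose_mat K2 * B)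
      (transpose_mat K2) K1 (0\<^sub>m (d * n) (\<mu> * m))"
    and grade: "has_grade 1 L"
  shows "is_linearization L (mat m n (\<lambda>(s, t). \<Sum>i\<le>k. a ^ (k - i) * (\<Prod>l\<in>{1..i}. \<beta> l) * Q i $$ (s, t)))"
    (is "is_linearization L ?P")
proof -
  obtain x1 w1 where x1: "x1 \<in> carrier_mat (d + 1) d" and w1: "w1 \<in> carrier_mat 1 (d + 1)"
    and e1: "chain_mat a (\<lambda>i. \<beta> (\<mu> + d - i)) d * x1 = 1\<^sub>m d" "w1 * x1 = 0\<^sub>m 1 d"
      "w1 * chain_kernel a (\<lambda>i. \<beta> (\<mu> + d - i)) d = 1\<^sub>m 1"
    by (rule chain_dual_completion[of d a "\<lambda>i. \<beta> (\<mu> + d - i)"]) (use com \<mu> in auto)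
  obtain x2 w2 where x2: "x2 \<in> carrier_mat (\<mu> + 1) \<mu>" and w2: "w2 \<in> carrier_mat 1 (\<mu> + 1)"
    and e2: "chain_mat a (\<lambda>i. \<beta> (\<mu> - i)) \<mu> * x2 = 1\<^sub>m \<mu>" "w2 * x2 = 0\<^sub>m 1 \<mu>"
      "w2 * chain_kernel a (\<lambda>i. \<beta> (\<mu> - i)) \<mu> = 1\<^sub>m 1"
    by (rule chain_dual_completion[of \<mu> a "\<lambda>i. \<beta> (\<mu> - i)"]) (use com \<mu> in auto)
  define l1 where "l1 = chain_kernel a (\<lambda>i. \<beta> (\<mu> + d - i)) d"
  define l2 where "l2 = chain_kernel a (\<lambda>i. \<beta> (\<mu> - i)) \<mu>"
  define X1 where "X1 = kron_one n x1"
  define W1 where "W1 = kron_one n w1"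
  define L1 where "L1 = kron_one n l1"
  define X2 where "X2 = kron_one m x2"
  define W2 where "W2 = kron_one m w2"
  define L2 where "L2 = kron_one m l2"
  have l: "l1 \<in> carrier_mat (d + 1) 1" "l2 \<in> carrier_mat (\<mu> + 1) 1"
    by (simp_all only: l1_def l2_def chain_kernel_carrier)
  have c1: "K1 \<in> carrier_mat (d * n) (d * n + n)" "X1 \<in> carrier_mat (d * n + n) (d * n)"
    "W1 \<in> carrier_mat n (d * n + n)" "L1 \<in> carrier_mat (d * n + n) n"
    using kron_one_carrier[OF chain_mat_carrier, of n a "\<lambda>i. \<beta> (\<mu> + d - i)" d]
      kron_one_carrier[OF x1, of n] kron_one_carrier[OF w1, of n] kron_one_carrier[OF l(1), of n]
    by (simp_all add: K1 X1_def W1_def L1_def add.commute)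
  have c2: "K2 \<in> carrier_mat (\<mu> * m) (\<mu> * m + m)" "X2 \<in> carrier_mat (\<mu> * m + m) (\<mu> * m)"
    "W2 \<in> carrier_mat m (\<mu> * m + m)" "L2 \<in> carrier_mat (\<mu> * m + m) m"
    using kron_one_carrier[OF chain_mat_carrier, of m a "\<lambda>i. \<beta> (\<mu> - i)" \<mu>]
      kron_one_carrier[OF x2, of m] kron_one_carrier[OF w2, of m] kron_one_carrier[OF l(2), of m]
    by (simp_all add: K2 X2_def W2_def L2_def add.commute)
  have p1: "K1 * X1 = 1\<^sub>m (d * n)" "K1 * L1 = 0\<^sub>m (d * n) n" "W1 * X1 = 0\<^sub>m n (d * n)" "W1 * L1 = 1\<^sub>m n"
    unfolding K1 X1_def W1_def L1_def l1_def
    by (simp_all only: kron_one_mult[OF chain_mat_carrier x1] kron_one_mult[OF chain_mat_carrier chain_kernel_carrier]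
        kron_one_mult[OF w1 x1] kron_one_mult[OF w1 chain_kernel_carrier] e1 chain_mat_mult_kernel
        kron_one_one kron_one_zero mult_1)
  have p2: "K2 * X2 = 1\<^sub>m (\<mu> * m)" "K2 * L2 = 0\<^sub>m (\<mu> * m) m" "W2 * X2 = 0\<^sub>m m (\<mu> * m)" "W2 * L2 = 1\<^sub>m m"
    unfolding K2 X2_def W2_def L2_def l2_def
    by (simp_all only: kron_one_mult[OF chain_mat_carrier x2] kron_one_mult[OF chain_mat_carrier chain_kernel_carrier]
        kron_one_mult[OF w2 x2] kron_one_mult[OF w2 chain_kernel_carrier] e2 chain_mat_mult_kernel
        kron_one_one kron_one_zero mult_1)
  \<comment> \<open>Transposition turns the completion of the rows of \<open>K2\<close> into one of
    the columns of its transpose; \<open>X2\<close>, \<open>L2\<close> and \<open>W2\<close> take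
    the roles of \<open>E\<close>, \<open>F\<close> and \<open>G\<close>.\<close>
  have t2: "transpose_mat X2 * transpose_mat K2 = 1\<^sub>m (\<mu> * m)" "transpose_mat L2 * transpose_mat K2 = 0\<^sub>m m (\<mu> * m)"
    "transpose_mat X2 * transpose_mat W2 = 0\<^sub>m (\<mu> * m) m" "transpose_mat L2 * transpose_mat W2 = 1\<^sub>m m"
    using p2 by (simp_all flip: transpose_mult[OF c2(1,2)] transpose_mult[OF c2(1,4)]
      transpose_mult[OF c2(3,2)] transpose_mult[OF c2(3,4)])
  define D where "D = homog_corner a \<beta> k \<mu> m n Q"
  have kd: "k - \<mu> = d + 1" using \<mu> by simp
  have D: "D \<in> carrier_mat (\<mu> * m + m) (d * n + n)"
    unfolding D_def homog_corner_def kd using block_matrix_carrier[of "\<mu> + 1" "d + 1" m n] by (simp add: add.commute)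
  have A': "A \<in> carrier_mat (\<mu> * m + m) (d * n)" and B': "B \<in> carrier_mat (\<mu> * m) (d * n + n)"
    using A B by (simp_all add: add.commute)
  let ?F = "transpose_mat L2" and ?J = "transpose_mat K2"
  have F: "?F \<in> carrier_mat m (\<mu> * m + m)" and J: "?J \<in> carrier_mat (\<mu> * m + m) (\<mu> * m)"
    using c2 by simp_all
  have AK: "A * K1 \<in> carrier_mat (\<mu> * m + m) (d * n + n)" and JB: "?J * B \<in> carrier_mat (\<mu> * m + m) (d * n + n)"
    using A' B' c1 J by auto
  have FD: "?F * D \<in> carrier_mat m (d * n + n)" and FAK: "?F * (A * K1) \<in> carrier_mat m (d * n + n)"
    using F D AK by auto
  have FA: "?F * A \<in> carrier_mat m (d * n)" using F A' by auto
  \<comment> \<open>The \<open>B\<close> term dies from the left, by the kernel of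
    \<open>K2\<close>; the \<open>A\<close> term will die from the right, by the kernel of
    \<open>K1\<close>.\<close>
  have FJB: "?F * (?J * B) = 0\<^sub>m m (d * n + n)"
    using assoc_mult_mat[OF F J B'] t2(2) left_mult_zero_mat[OF B'] by simp
  have "?F * (D + A * K1 + ?J * B) = ?F * D + ?F * (A * K1)"
    using right_add_zero_mat[OF add_carrier_mat[OF FAK]] FJB mult_add_distrib_mat[OF F D AK] mult_add_distrib_mat[OF F add_carrier_mat[OF AK] JB, of D]
      by simp
  then have "?F * (D + A * K1 + ?J * B) * L1 = ?F * D * L1 + ?F * A * (K1 * L1)"
    using add_mult_distrib_mat[OF FD FAK c1(4)] assoc_mult_mat[OF F A' c1(1)] assoc_mult_mat[OF FA c1(1,4)] by simp
  also have "\<dots> = ?F * D * L1"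
    by (simp only: p1(2) right_mult_zero_mat[OF FA] right_add_zero_mat[OF mult_carrier_mat[OF FD c1(4)]])
  also have "\<dots> = ?P"
  proof (rule eq_matI)
    fix s t :: nat
    assume "s < dim_row ?P" "t < dim_col ?P"
    then have st: "s < m" "t < n" by auto
    have entry: "(\<beta> k \<cdot>\<^sub>m Q k + a \<cdot>\<^sub>m Q (k - 1)) $$ (s, t) = \<beta> k * Q k $$ (s, t) + a * Q (k - 1) $$ (s, t)"
      "i \<le> k \<Longrightarrow> (a \<cdot>\<^sub>m Q i) $$ (s, t) = a * Q i $$ (s, t)" for i
      using Q[of k] Q[of "k - 1"] Q[of i] st by auto
    have l1: "l1 $$ (j, 0) = a ^ j * (\<Prod>l\<in>{\<mu> + 1..\<mu> + d - j}. \<beta> l)" if "j < d + 1" for j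
      using that prod_reverse_interval[of j d \<beta> \<mu>] by (simp add: l1_def chain_kernel_def)
    have l2: "transpose_mat l2 $$ (0, i) = a ^ i * (\<Prod>l\<in>{1..\<mu> - i}. \<beta> l)" if "i < \<mu> + 1" for i
      using that prod_reverse_interval[of i \<mu> \<beta> 0] by (simp add: l2_def chain_kernel_def)
    have kd': "k - Suc \<mu> = d" and le: "\<mu> - i \<le> k" for i using \<mu> by auto
    have "(?F * D * L1) $$ (s, t) = (\<Sum>i<\<mu> + 1. \<Sum>j<d + 1. transpose_mat l2 $$ (0, i) * l1 $$ (j, 0) *
      (if i = 0 \<and> j = 0 then \<beta> k \<cdot>\<^sub>m Q k + a \<cdot>\<^sub>m Q (k - 1)
            else if i = 0 then a \<cdot>\<^sub>m Q (k - 1 - j)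
            else if j = k - \<mu> - 1 then a \<cdot>\<^sub>m Q (\<mu> - i)
            else 0\<^sub>m m n) $$ (s, t))"
      unfolding D_def L1_def L2_def homog_corner_def kron_one_transpose kd
      by (rule kron_one_block_matrix_kron_one) (use l st in auto)
    also have "\<dots> = (\<Sum>i<\<mu> + 1. \<Sum>j<d + 1. (a ^ i * (\<Prod>l\<in>{1..\<mu> - i}. \<beta> l)) * 
      (a ^ j * (\<Prod>l\<in>{\<mu> + 1..\<mu> + d - j}. \<beta> l)) *
      (if i = 0 \<and> j = 0 then \<beta> k * Q k $$ (s, t) + a * Q (k - 1) $$ (s, t) else if i = 0 then a * Q (k - 1 - j) $$ (s, t)
       else if j = d then a * Q (\<mu> - i) $$ (s, t) else 0))"
      using st kd' le by (intro sum.cong refl) (auto simp: entry entry(1)[unfolded One_nat_def] l1 l2 simp del: index_transpose_mat)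
    also have "\<dots> = (\<Sum>i\<le>k. a ^ (k - i) * (\<Prod>l\<in>{1..i}. \<beta> l) * Q i $$ (s, t))"
      by (rule homog_corner_sum[OF \<mu>])
    finally show "(?F * D * L1) $$ (s, t) = ?P $$ (s, t)" using st by simp
  qed (use F D c1 in auto)
  finally have main: "?F * (D + A * K1 + ?J * B) * L1 = ?P" .
  have DAB: "D + A * K1 + ?J * B \<in> carrier_mat (\<mu> * m + m) (d * n + n)" using JB by simp
  show ?thesis
    unfolding L D_def[symmetric]
    by (rule dual_completion_linearization[OF DAB c1(1,2,4,3) p1 J _ F _ t2(1,2,3,4) main])
       (use c2 grade in \<open>auto simp: L D_def\<close>)
qed

subsection \<open>Reversal of Newton polynomials\<close>

lemma rev_poly_coeff: "coeff (rev_poly g q) i = (if i \<le> g then coeff q (g - i) else 0)"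
proof -
  have "coeff (rev_poly g q) i = (\<Sum>j\<le>g. if g - j = i then coeff q j else 0)"
    by (simp add: rev_poly_def coeff_sum)
  \<comment> \<open>For \<open>i > g\<close> truncated subtraction makes \<open>g - i\<close> equal
    to 0, hence the inner guard.\<close>
  also have "\<dots> = (\<Sum>j\<le>g. if j = g - i then (if i \<le> g then coeff q j else 0) else 0)"
    by (rule sum.cong) auto
  finally show ?thesis by simp
qed

lemma degree_rev_poly: "degree (rev_poly g q) \<le> g"
  by (rule degree_le) (simp add: rev_poly_coeff)

lemma rev_poly_add: "rev_poly g (p + q) = rev_poly g p + rev_poly g q"
  by (rule poly_eqI) (simp add: rev_poly_coeff)

lemma rev_poly_zero: "rev_poly g 0 = 0"
  by (rule poly_eqI) (simp add: rev_poly_coeff)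

lemma rev_poly_sum: "rev_poly g (\<Sum>i\<in>I. f i) = (\<Sum>i\<in>I. rev_poly g (f i))"
  by (induction I rule: infinite_finite_induct) (simp_all add: rev_poly_zero rev_poly_add)

lemma rev_poly_smult: "rev_poly g (smult c p) = smult c (rev_poly g p)"
  by (rule poly_eqI) (simp add: rev_poly_coeff)

text \<open>Reversal is multiplicative when the grades add up; a factor of grade 1 just swaps its
  two coefficients.\<close>

lemma rev_poly_linear_mult:
  assumes "degree q \<le> g"
  shows "rev_poly (Suc g) ([:c, d:] * q) = [:d, c:] * rev_poly g q"
proof (rule poly_eqI)
  fix i
  have "coeff q (Suc g) = 0" using assms by (simp add: coeff_eq_0)
  moreover have "g - j = Suc (g - Suc j)" if "Suc j \<le> g" for j using that by simp
  ultimately show "coeff (rev_poly (Suc g) ([:c, d:] * q)) i = coeff ([:d, c:] * rev_poly g q) i"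
    by (cases i) (auto simp: rev_poly_coeff coeff_pCons Suc_diff_le coeff_eq_0 not_less_eq_eq split: nat.split)
qed

lemma degree_newton_poly: "degree (newton_poly x i) \<le> i"
proof -
  have "degree (newton_poly x i) \<le> (\<Sum>l\<in>{1..i}. degree (node_factor x l))"
    unfolding newton_poly_def using degree_prod_sum_le[of "{1..i}" "node_factor x"] by (simp add: o_def)
  also have "\<dots> = i" by (simp add: node_factor_def)
  finally show ?thesis .
qed

lemma newton_poly_Suc: "newton_poly x (Suc i) = node_factor x (Suc i) * newton_poly x i"
  by (simp add: newton_poly_def mult.commute)

text \<open>The product is first reversed with grade \<open>i\<close>, factor by factor. Every
  further unit of grade contributes one factor of the indeterminate, which is the origin of
  \<open>a ^ (k - i)\<close> in the homogeneous sum.\<close>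

lemma rev_newton_poly:
  assumes "i \<le> g"
  shows "rev_poly g (newton_poly x i) = [:0, 1:] ^ (g - i) * (\<Prod>l\<in>{1..i}. [:1, - x l:])"
proof -
  have base: "rev_poly i (newton_poly x i) = (\<Prod>l\<in>{1..i}. [:1, - x l:])" for i
  proof (induction i)
    case 0
    then show ?case by (simp add: newton_poly_def rev_poly_def)
  next
    case (Suc i)
    then show ?case
      unfolding newton_poly_Suc node_factor_def
      by (subst rev_poly_linear_mult[OF degree_newton_poly]) (simp add: mult.commute)
  qed
  have "rev_poly (i + e) (newton_poly x i) = [:0, 1:] ^ e * rev_poly i (newton_poly x i)" for e
  proof (induction e)
    case (Suc e)
    have "degree (newton_poly x i) \<le> i + e" using degree_newton_poly[of x i] by linarith
    \<comment> \<open>Here the linear factor is the constant 1 taken with grade 1, whose reversal is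
      the indeterminate.\<close>
    from rev_poly_linear_mult[OF this, of 1 0] Suc show ?case by simp
  qed simp
  from this[of "g - i"] base show ?thesis using assms by simp
qed

lemma rev_newton_matpoly:
  assumes "\<And>i. i \<le> k \<Longrightarrow> P i \<in> carrier_mat m n"
  shows "rev_mat k (newton_matpoly k m n x P) = mat m n (\<lambda>(s, t). \<Sum>i\<le>k. [:0, 1:] ^ (k - i) *
    (\<Prod>l\<in>{1..i}. [:1, - x l:]) * const_matpoly (P i) $$ (s, t))"
proof -
  have "dim_row (P i) = m" "dim_col (P i) = n" if "i \<le> k" for i
    using assms[OF that] by auto
  then show ?thesis
    by (intro eq_matI) (auto simp: rev_mat_def newton_matpoly_def const_matpoly_def rev_poly_sum
        rev_poly_smult rev_newton_poly intro!: sum.cong)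
qed

text \<open>The power \<open>1 ^ (k - i)\<close> is kept to match the homogeneous sum at
  \<open>a = 1\<close>.\<close>

lemma newton_matpoly_homog:
  assumes "\<And>i. i \<le> k \<Longrightarrow> P i \<in> carrier_mat m n"
  shows "newton_matpoly k m n x P = mat m n (\<lambda>(s, t). \<Sum>i\<le>k. 1 ^ (k - i) *
    (\<Prod>l\<in>{1..i}. node_factor x l) * const_matpoly (P i) $$ (s, t))"
proof -
  have "dim_row (P i) = m" "dim_col (P i) = n" if "i \<le> k" for i
    using assms[OF that] by auto
  then show ?thesis
    by (intro eq_matI) (auto simp: newton_matpoly_def newton_poly_def const_matpoly_def intro!: sum.cong)
qed

subsection \<open>The Newton pencil and its reversal\<close>

lemma block_matrix_cong:
  assumes "\<And>i j s t. i < R \<Longrightarrow> j < C \<Longrightarrow> s < p \<Longrightarrow> t < q \<Longrightarrow> F i j $$ (s, t) = G i j $$ (s, t)"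
  shows "block_matrix R C p q F = block_matrix R C p q G"
proof -
  \<comment> \<open>An index inside the matrix rules out empty blocks, so the remainders stay below
    the block sizes.\<close>
  have "p > 0" "q > 0" if "a < R * p" "b < C * q" for a b using that by (auto intro: gr0I)
  then show ?thesis
    unfolding block_matrix_def by (intro eq_matI) (auto simp: less_mult_imp_div_less intro!: assms)
qed

lemma map_block_matrix:
  "map_mat f (block_matrix R C p q F) = block_matrix R C p q (\<lambda>i j. mat p q (\<lambda>(s, t). f (F i j $$ (s, t))))"
proof -
  have "p > 0" "q > 0" if "a < R * p" "b < C * q" for a b using that by (auto intro: gr0I)
  then show ?thesis
    unfolding block_matrix_def by (intro eq_matI) auto
qed

text \<open>Connects the Kronecker form, in which the algebra is done, with the block form in which
  the Newton pencils are defined.\<close>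

lemma kron_one_chain_block:
  "kron_one n (chain_mat a b d) = block_matrix d (d + 1) n n
     (\<lambda>i j. if j = i then - (a \<cdot>\<^sub>m 1\<^sub>m n) else if j = i + 1 then b i \<cdot>\<^sub>m 1\<^sub>m n else 0\<^sub>m n n)"
proof -
  have "n > 0" if "a < d * n" for a using that by (auto intro: gr0I)
  then show ?thesis
    by (intro eq_matI) (auto simp: kron_one_def chain_mat_def block_matrix_def less_mult_imp_div_less)
qed

text \<open>The index \<open>\<mu> + d - i\<close> is \<open>k - 1 - i\<close>. Reversal with grade
  1 sends 1 to the indeterminate and \<open>[:- x l, 1:]\<close> to \<open>[:1, - x l:]\<close>,
  which gives the second choice of \<open>a\<close> and the \<open>\<beta> l\<close>.\<close>

lemma K1_newton_eq:
  assumes "\<mu> + d + 1 = k"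
  shows "K1_newton k \<mu> n x = kron_one n (chain_mat 1 (\<lambda>i. node_factor x (\<mu> + d - i)) d)"
    and "rev_mat 1 (K1_newton k \<mu> n x) = kron_one n (chain_mat [:0, 1:] (\<lambda>i. [:1, - x (\<mu> + d - i):]) d)"
  using assms unfolding K1_newton_def kron_one_chain_block rev_mat_def map_block_matrix
  by (auto intro!: block_matrix_cong simp: node_factor_def rev_poly_def monom_Suc monom_0 one_pCons)

lemma K2_newton_eq:
  "K2_newton \<mu> m x = kron_one m (chain_mat 1 (\<lambda>i. node_factor x (\<mu> - i)) \<mu>)"
  "rev_mat 1 (K2_newton \<mu> m x) = kron_one m (chain_mat [:0, 1:] (\<lambda>i. [:1, - x (\<mu> - i):]) \<mu>)"
  unfolding K2_newton_def kron_one_chain_block rev_mat_def map_block_matrix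
  by (auto intro!: block_matrix_cong simp: node_factor_def rev_poly_def monom_Suc monom_0 one_pCons)

lemma M_newton_eq:
  assumes "\<mu> + d + 1 = k" and P: "\<And>i. i \<le> k \<Longrightarrow> P i \<in> carrier_mat m n"
  shows "M_newton k \<mu> m n x P = homog_corner 1 (node_factor x) k \<mu> m n (\<lambda>i. const_matpoly (P i))"
    and "rev_mat 1 (M_newton k \<mu> m n x P) =
      homog_corner [:0, 1:] (\<lambda>l. [:1, - x l:]) k \<mu> m n (\<lambda>i. const_matpoly (P i))"
proof -
  have dim: "dim_row (P i) = m" "dim_col (P i) = n" if "i \<le> k" for i
    using P[OF that] by auto
  have le: "k - Suc j \<le> k" "\<mu> - i \<le> k" for i j using assms(1) by auto
  show "M_newton k \<mu> m n x P = homog_corner 1 (node_factor x) k \<mu> m n (\<lambda>i. const_matpoly (P i))"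
    unfolding M_newton_def homog_corner_def
    by (rule block_matrix_cong) (auto simp: const_matpoly_def dim le)
  show "rev_mat 1 (M_newton k \<mu> m n x P) =
      homog_corner [:0, 1:] (\<lambda>l. [:1, - x l:]) k \<mu> m n (\<lambda>i. const_matpoly (P i))"
    unfolding M_newton_def homog_corner_def rev_mat_def map_block_matrix
    by (rule block_matrix_cong) (auto simp: const_matpoly_def dim le node_factor_def rev_poly_def monom_Suc monom_0 one_pCons)
qed

section \<open>Reversal of the assembled pencil\<close>

text \<open>Reversal with a fixed grade is not multiplicative, but it is linear over the constants,
  and that is enough for a constant factor.\<close>

lemma rev_mat_const_mult_left:
  assumes "K \<in> carrier_mat p q" "A \<in> carrier_mat r p"
  shows "rev_mat g (const_matpoly A * K) = const_matpoly A * rev_mat g K"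
  by (rule eq_matI) (use assms in \<open>auto simp: rev_mat_def const_matpoly_def scalar_prod_def rev_poly_sum rev_poly_smult\<close>)

lemma rev_mat_const_mult_right:
  assumes "K \<in> carrier_mat r p" "B \<in> carrier_mat p q"
  shows "rev_mat g (K * const_matpoly B) = rev_mat g K * const_matpoly B"
  by (rule eq_matI) (use assms in \<open>auto simp: rev_mat_def const_matpoly_def scalar_prod_def rev_poly_sum rev_poly_smult\<close>)

lemma rev_mat_add:
  assumes "A \<in> carrier_mat r c" "B \<in> carrier_mat r c"
  shows "rev_mat g (A + B) = rev_mat g A + rev_mat g B"
  by (rule eq_matI) (use assms in \<open>auto simp: rev_mat_def rev_poly_add\<close>)

lemma rev_mat_transpose: "rev_mat g (transpose_mat A) = transpose_mat (rev_mat g A)"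
  by (rule eq_matI) (auto simp: rev_mat_def)

lemma rev_mat_four_block:
  assumes "A \<in> carrier_mat r1 c1" "B \<in> carrier_mat r1 c2" "C \<in> carrier_mat r2 c1" "D \<in> carrier_mat r2 c2"
  shows "rev_mat g (four_block_mat A B C D) =
    four_block_mat (rev_mat g A) (rev_mat g B) (rev_mat g C) (rev_mat g D)"
  unfolding rev_mat_def by (rule map_four_block_mat[OF assms])

section \<open>Grade bounds for the pencil and its blocks\<close>

lemma has_grade_rev_mat: "has_grade g (rev_mat g A)"
  by (simp add: has_grade_def rev_mat_def degree_rev_poly)

lemma has_grade_add:
  assumes "A \<in> carrier_mat r c" "B \<in> carrier_mat r c" "has_grade g A" "has_grade g B"
  shows "has_grade g (A + B)"
  using assms by (auto simp: has_grade_def intro!: degree_add_le)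

lemma has_grade_const_mult_left:
  assumes "K \<in> carrier_mat p q" "A \<in> carrier_mat r p" "has_grade g K"
  shows "has_grade g (const_matpoly A * K)"
  using assms by (auto simp: has_grade_def const_matpoly_def scalar_prod_def intro!: degree_sum_le order_trans[OF degree_smult_le])

lemma has_grade_const_mult_right:
  assumes "K \<in> carrier_mat r p" "B \<in> carrier_mat p q" "has_grade g K"
  shows "has_grade g (K * const_matpoly B)"
  using assms by (auto simp: has_grade_def const_matpoly_def scalar_prod_def intro!: degree_sum_le order_trans[OF degree_smult_le])

lemma has_grade_transpose: "has_grade g A \<Longrightarrow> has_grade g (transpose_mat A)"
  by (auto simp: has_grade_def)

lemma has_grade_zero: "has_grade g (0\<^sub>m r c)"
  by (auto simp: has_grade_def)

lemma has_grade_four_block: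
  assumes "A \<in> carrier_mat r1 c1" "B \<in> carrier_mat r1 c2" "C \<in> carrier_mat r2 c1" "D \<in> carrier_mat r2 c2"
    and "has_grade g A" "has_grade g B" "has_grade g C" "has_grade g D"
  shows "has_grade g (four_block_mat A B C D)"
  using assms by (auto simp: has_grade_def)

lemma has_grade_block_matrix:
  assumes "\<And>i j s t. i < R \<Longrightarrow> j < C \<Longrightarrow> s < p \<Longrightarrow> t < q \<Longrightarrow> degree (F i j $$ (s, t)) \<le> g"
  shows "has_grade g (block_matrix R C p q F)"
proof -
  have "p > 0" "q > 0" if "a < R * p" "b < C * q" for a b using that by (auto intro: gr0I)
  then show ?thesis
    unfolding block_matrix_def has_grade_def by (auto simp: less_mult_imp_div_less intro!: assms)
qed

lemma has_grade_newton_blocks: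
  shows "has_grade 1 (K1_newton k \<mu> n x)" "has_grade 1 (K2_newton \<mu> m x)"
  unfolding K1_newton_def K2_newton_def
  by (auto intro!: has_grade_block_matrix simp: node_factor_def)

lemma has_grade_M_newton:
  assumes "\<mu> + d + 1 = k" and P: "\<And>i. i \<le> k \<Longrightarrow> P i \<in> carrier_mat m n"
  shows "has_grade 1 (M_newton k \<mu> m n x P)"
proof -
  have dim: "dim_row (P i) = m" "dim_col (P i) = n" if "i \<le> k" for i
    using P[OF that] by auto
  have le: "k - Suc j \<le> k" "\<mu> - i \<le> k" for i j using assms(1) by auto
  show ?thesis
    unfolding M_newton_def
    by (rule has_grade_block_matrix) (auto simp: const_matpoly_def dim le node_factor_def)
qed

section \<open>Strong linearization from the two homogeneous instances\<close>

theorem theorem3p3: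
  fixes k m n \<mu> :: nat
    and x :: "nat \<Rightarrow> complex"
    and P :: "nat \<Rightarrow> complex mat"
    and A B :: "complex mat"
  assumes "k \<ge> 1" and "m \<ge> 1" and "n \<ge> 1"
    and "inj_on x {1..k}"
    and "\<And>i. i \<le> k \<Longrightarrow> P i \<in> carrier_mat m n"
    and "\<mu> \<le> k - 1"
    and "A \<in> carrier_mat ((\<mu> + 1) * m) ((k - \<mu> - 1) * n)"
    and "B \<in> carrier_mat (\<mu> * m) ((k - \<mu>) * n)"
  shows "is_strong_linearization k (N_newton k \<mu> m n x P A B) (newton_matpoly k m n x P)"
proof -
  define d where "d = k - \<mu> - 1"
  have \<mu>: "\<mu> + d + 1 = k" and kd: "k - \<mu> - 1 = d" "k - \<mu> = d + 1" "d + 1 - 1 = d"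
    using assms(1,6) by (auto simp: d_def)
  note P = assms(5)
  have A: "A \<in> carrier_mat ((\<mu> + 1) * m) (d * n)" and B: "B \<in> carrier_mat (\<mu> * m) ((d + 1) * n)"
    using assms(7,8) by (simp_all only: kd)
  let ?K1 = "K1_newton k \<mu> n x" and ?K2 = "K2_newton \<mu> m x" and ?M = "M_newton k \<mu> m n x P"
  let ?J = "transpose_mat ?K2" and ?A = "const_matpoly A" and ?B = "const_matpoly B"
  let ?Q = "\<lambda>i. const_matpoly (P i)"
  have K1: "?K1 \<in> carrier_mat (d * n) ((d + 1) * n)" and K2: "?K2 \<in> carrier_mat (\<mu> * m) ((\<mu> + 1) * m)"
    and M: "?M \<in> carrier_mat ((\<mu> + 1) * m) ((d + 1) * n)"
    unfolding K1_newton_def K2_newton_def M_newton_def kd by (rule block_matrix_carrier)+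
  have J: "?J \<in> carrier_mat ((\<mu> + 1) * m) (\<mu> * m)" using K2 by (rule transpose_carrier_mat[THEN iffD2])
  have A': "?A \<in> carrier_mat ((\<mu> + 1) * m) (d * n)" and B': "?B \<in> carrier_mat (\<mu> * m) ((d + 1) * n)"
    using A B by (simp_all only: const_matpoly_def map_carrier_mat)
  have Q: "?Q i \<in> carrier_mat m n" if "i \<le> k" for i using P[OF that] by (simp add: const_matpoly_def)
  note AK = mult_carrier_mat[OF A' K1] and JB = mult_carrier_mat[OF J B']
  note MAK = add_carrier_mat[OF AK, of ?M]
  note corner = add_carrier_mat[OF JB, of "?M + ?A * ?K1"]
  let ?N = "N_newton k \<mu> m n x P A B"
  have N: "?N = four_block_mat (?M + ?A * ?K1 + ?J * ?B) ?J ?K1 (0\<^sub>m (d * n) (\<mu> * m))"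
    by (simp only: N_newton_def kd)
  have grade: "has_grade 1 ?N"
    unfolding N
    by (intro has_grade_four_block[OF corner J K1 zero_carrier_mat] has_grade_add[OF MAK JB] has_grade_add[OF M AK]
        has_grade_const_mult_left[OF K1 A] has_grade_const_mult_right[OF J B] has_grade_transpose has_grade_zero
        has_grade_newton_blocks has_grade_M_newton[OF \<mu> P])
  have revN: "rev_mat 1 ?N = four_block_mat (rev_mat 1 ?M + ?A * rev_mat 1 ?K1 + transpose_mat (rev_mat 1 ?K2) * ?B)
      (transpose_mat (rev_mat 1 ?K2)) (rev_mat 1 ?K1) (0\<^sub>m (d * n) (\<mu> * m))"
  proof -
    have "rev_mat 1 (0\<^sub>m (d * n) (\<mu> * m)) = 0\<^sub>m (d * n) (\<mu> * m)"
      by (rule eq_matI) (auto simp: rev_mat_def rev_poly_zero)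
    then show ?thesis
      unfolding N
      by (simp only: rev_mat_four_block[OF corner J K1 zero_carrier_mat] rev_mat_add[OF MAK JB] rev_mat_add[OF M AK]
        rev_mat_const_mult_left[OF K1 A] rev_mat_const_mult_right[OF J B] rev_mat_transpose)
  qed
  have M1: "?M = homog_corner 1 (node_factor x) k \<mu> m n ?Q"
    by (rule M_newton_eq(1)[OF \<mu>]) (rule P)
  have M2: "rev_mat 1 ?M = homog_corner [:0, 1:] (\<lambda>l. [:1, - x l:]) k \<mu> m n ?Q"
    by (rule M_newton_eq(2)[OF \<mu>]) (rule P)
  have homog: "newton_matpoly k m n x P = mat m n (\<lambda>(s, t). \<Sum>i\<le>k. 1 ^ (k - i) *
      (\<Prod>l\<in>{1..i}. node_factor x l) * ?Q i $$ (s, t))"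
    by (rule newton_matpoly_homog) (rule P)
  have "is_linearization ?N (newton_matpoly k m n x P)"
    unfolding homog
  \<comment> \<open>The instance \<open>a = 1\<close>, where comaximality is trivial.\<close>
  proof (rule homog_pencil_linearization[OF \<mu> _ _ A' B' K1_newton_eq(1)[OF \<mu>] K2_newton_eq(1)
          N[unfolded M1] grade])
    show "comaximal 1 (node_factor x l)" for l
      using comaximal_one_right comaximal_commute by blast
  qed (rule Q)
  moreover have "rev_mat k (newton_matpoly k m n x P) = mat m n (\<lambda>(s, t). \<Sum>i\<le>k. [:0, 1:] ^ (k - i) *
      (\<Prod>l\<in>{1..i}. [:1, - x l:]) * ?Q i $$ (s, t))"
    by (rule rev_newton_matpoly) (rule P)
  moreover have "is_linearization (rev_mat 1 ?N) (mat m n (\<lambda>(s, t). \<Sum>i\<le>k. [:0, 1:] ^ (k - i) *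
      (\<Prod>l\<in>{1..i}. [:1, - x l:]) * ?Q i $$ (s, t)))"
  \<comment> \<open>The instance where \<open>a\<close> is the indeterminate; \<open>x l\<close>
    times \<open>a\<close> plus \<open>1 - x l * a\<close> is the Bezout identity.\<close>
  proof (rule homog_pencil_linearization[OF \<mu> _ _ A' B' K1_newton_eq(2)[OF \<mu>] K2_newton_eq(2)
          revN[unfolded M2] has_grade_rev_mat])
    show "comaximal [:0, 1:] [:1, - x l:]" for l
      unfolding comaximal_def by (rule exI[of _ "[:x l:]"], rule exI[of _ 1]) (simp add: one_pCons)
  qed (rule Q)
  moreover have "has_grade k (newton_matpoly k m n x P)"
    unfolding has_grade_def newton_matpoly_def
    by (auto intro!: degree_sum_le order_trans[OF degree_smult_le] order_trans[OF degree_newton_poly])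
  ultimately show ?thesis
    unfolding is_strong_linearization_def by simp
qed

end
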